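(* Let $\Omega$ be a connected weighted simplicial complex on $[n]$ with a free group action from the finite group $G$, and fix $\varepsilon>0$. Let $p\in\mathcal P^h_{2d}$ be separable (with respect to the local sum-of-squares cones) and $G$-invariant. Then there exists $q\in\mathcal P^h_{2d}$ such that $\|p-q\|_\infty<\varepsilon$ and $$\operatorname{sep-rank}_{(\Omega,G)}(q)\le\left\lceil\frac{8\exp(4)\cdot\mu(p)^2}{\varepsilon^2}\right\rceil\cdot|G| .$$
   Context: $[n]=\{0,\dots,n\}$ and $\mathbb N=\{0,1,2,\dots\}$. A weighted simplicial complex on $[n]$ is a map $\Omega$ from the power set of $[n]$ to $\mathbb N$ such that $\Omega(S_1)$ divides $\Omega(S_2)$ whenever $S_1\subseteq S_2$; it is always assumed that $\Omega(\{i\})\neq 0$ for all $i\in[n]$. Sets $S$ with $\Omega(S)\ne0$ are called simplices, inclusion-maximal simplices are called facets, and $\mathcal F$ is the set of facets. $\widetilde{\mathcal F}$ is the multiset containing each facet $F$ exactly $\Omega(F)$ times (copies are regarded as distinct elements), $c:\widetilde{\mathcal F}\to\mathcal F$ maps each copy to its underlying facet, and $\widetilde{\mathcal F}_i=\{\mathfrak f\in\widetilde{\mathcal F}: i\in c(\mathfrak f)\}$. Two vertices are neighbours if some facet contains both; $\Omega$ is connected if any two vertices are joined by a chain of consecutive neighbours. An action of a finite group $G$ on $\Omega$ consists of an action of $G$ on $[n]$ with $\Omega(gS)=\Omega(S)$ for all $g\in G$, $S\subseteq[n]$, together with an action of $G$ on the set $\widetilde{\mathcal F}$ such that $c(g\mathfrak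 f)=g\,c(\mathfrak f)$. The action on $\Omega$ is called free if the action on $\widetilde{\mathcal F}$ is free (all stabilizers are trivial). For $i\in[n]$, $\mathbf x^{[i]}=(x^{[i]}_0,\dots,x^{[i]}_m)$ is a vector of $m+1$ variables. $\mathcal P^h_{2d}$ is the space of polynomials in $\mathbb R[\mathbf x^{[0]},\dots,\mathbf x^{[n]}]$ that are homogeneous of degree $2d$ in each block $\mathbf x^{[i]}$. If $f\in\mathbb R[\mathbf x^{[i]}]$, then $f(\mathbf x^{[j]})$ denotes the polynomial obtained by substituting $\mathbf x^{[j]}$ for $\mathbf x^{[i]}$. $G$ acts by $(gp)(\mathbf x^{[0]},\dots,\mathbf x^{[n]})=p(\mathbf x^{[g0]},\dots,\mathbf x^{[gn]})$; $p$ is $G$-invariant if $gp=p$ for all $g\in G$. $p$ is separable if it is a finite sum of products $p^{[0]}(\mathbf x^{[0]})\cdots p^{[n]}(\mathbf x^{[n]})$ with every $p^{[i]}\in\mathbb R[\mathbf x^{[i]}]$ a sum of squares. With $\mathbb S^m\subseteq\mathbb R^{m+1}$ the Euclidean unit sphere, $\|p\|_\infty=\sup\{|p(\mathbf a^{[0]},\dots,\mathbf a^{[n]})|:\mathbf a^{[i]}\in\mathbb S^m\}$. Let $D=\binom{m+d}{d}$, let $\mathfrak m^h_d(\mathbf x^{[i]})$ be the vector of all monomials of degree exactly $d$ in $\mathbf x^{[i]}$ (in the same order for every $i$), $\mathfrak m^h_{n,d}=\mathfrak m^h_d(\mathbf x^{[0]})\otimes\cdots\otimes\mathfrak m^h_d(\mathbf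 x^{[n]})$, $\mathcal M_D$ the space of real $D\times D$ matrices, and $\mathcal G:\mathcal M_D^{\otimes n+1}\to\mathcal P^h_{2d}$, $\mathcal G(M)=(\mathfrak m^h_{n,d})^tM\,\mathfrak m^h_{n,d}$. A matrix $M\in\mathcal M_D^{\otimes n+1}$ is separable if $M=\sum_{j=1}^rM^{[0]}_j\otimes\cdots\otimes M^{[n]}_j$ with all $M^{[i]}_j$ real (symmetric) positive semidefinite; it is $G$-invariant if it is invariant under all permutations of the tensor factors induced by the action of $G$ on $[n]$. $\mathrm{SEP}_{n,D}$ is the set of separable $M\in\mathcal M_D^{\otimes n+1}$ with $\operatorname{tr}(M)\le1$. Define $$\mu(p)=\inf\{\lambda>0:\exists\,M\in\mathrm{SEP}_{n,D}\ G\text{-invariant with }p=\lambda\,\mathcal G(M)\},$$ which is finite for separable $G$-invariant $p\in\mathcal P^h_{2d}$. For sets $A,\mathcal I$, $\mathcal I^A$ denotes the set of functions $A\to\mathcal I$. For $\alpha\in\mathcal I^{\widetilde{\mathcal F}}$, $\alpha_{|_i}$ is its restriction to $\widetilde{\mathcal F}_i$. For $\beta\in\mathcal I^{\widetilde{\mathcal F}_i}$ and $g\in G$, ${}^g\beta\in\mathcal I^{\widetilde{\mathcal F}_{gi}}$ is defined by $({}^g\beta)(\mathfrak f)=\beta(g^{-1}\mathfrak f)$. A separable $(\Omega,G)$-decomposition of $q$ consists of a finite index set $\mathcal I$ and sum-of-squares polynomials $q^{[i]}_\beta\in\mathbb R[\mathbf x^{[i]}]$ for $i\in[n]$, $\beta\in\mathcal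 I^{\widetilde{\mathcal F}_i}$, such that $$q=\sum_{\alpha\in\mathcal I^{\widetilde{\mathcal F}}}q^{[0]}_{\alpha_{|_0}}(\mathbf x^{[0]})\cdots q^{[n]}_{\alpha_{|_n}}(\mathbf x^{[n]})$$ and $q^{[i]}_\beta(\mathbf x^{[i]})=q^{[gi]}_{{}^g\beta}(\mathbf x^{[i]})$ for all $i,g,\beta$. $\operatorname{sep-rank}_{(\Omega,G)}(q)$ is the minimal cardinality of $\mathcal I$ (the empty set being allowed, giving $q=0$) among all separable $(\Omega,G)$-decompositions of $q$, and $\infty$ if there is none. *)

theory Defs
  imports
    "HOL-Library.Poly_Mapping"
    "HOL-Library.Extended_Nat"
    "HOL-Algebra.Group_Action"
    "HOL-Analysis.Analysis"
begin

section \<open>Weighted simplicial complexes and group actions\<close>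

definition weighted_complex :: "nat \<Rightarrow> (nat set \<Rightarrow> nat) \<Rightarrow> bool" where
  "weighted_complex n \<Omega> \<longleftrightarrow>
     (\<forall>S1 S2. S1 \<subseteq> S2 \<and> S2 \<subseteq> {..n} \<longrightarrow> \<Omega> S1 dvd \<Omega> S2) \<and>
     (\<forall>i\<le>n. \<Omega> {i} \<noteq> 0)"

definition simplices :: "nat \<Rightarrow> (nat set \<Rightarrow> nat) \<Rightarrow> nat set set" where
  "simplices n \<Omega> = {S. S \<subseteq> {..n} \<and> \<Omega> S \<noteq> 0}"

definition facets :: "nat \<Rightarrow> (nat set \<Rightarrow> nat) \<Rightarrow> nat set set" where
  "facets n \<Omega> = {F \<in> simplices n \<Omega>. \<forall>S\<in>simplices n \<Omega>. F \<subseteq> S \<longrightarrow> S = F}"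

text \<open>The multiset of facets: the copies of a facet \<open>F\<close> are the pairs \<open>(F, k)\<close> with
  \<open>k < \<Omega> F\<close>, and the map from copies to underlying facets is \<open>fst\<close>.\<close>

definition facet_copies :: "nat \<Rightarrow> (nat set \<Rightarrow> nat) \<Rightarrow> (nat set \<times> nat) set" where
  "facet_copies n \<Omega> = (SIGMA F:facets n \<Omega>. {..<\<Omega> F})"

definition facet_copies_at :: "nat \<Rightarrow> (nat set \<Rightarrow> nat) \<Rightarrow> nat \<Rightarrow> (nat set \<times> nat) set" where
  "facet_copies_at n \<Omega> i = {f \<in> facet_copies n \<Omega>. i \<in> fst f}"

definition neighbours :: "nat \<Rightarrow> (nat set \<Rightarrow> nat) \<Rightarrow> (nat \<times> nat) set" where
  "neighbours n \<Omega> = {(i, j). \<exists>F\<in>facets n \<Omega>. i \<in> F \<and> j \<in> F}"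

definition connected_complex :: "nat \<Rightarrow> (nat set \<Rightarrow> nat) \<Rightarrow> bool" where
  "connected_complex n \<Omega> \<longleftrightarrow> (\<forall>i\<le>n. \<forall>j\<le>n. (i, j) \<in> (neighbours n \<Omega>)\<^sup>*)"

text \<open>\<open>\<phi>\<close> is the action on the vertices and \<open>\<psi>\<close> the action on the copies of facets.\<close>

definition complex_action ::
  "('g, 'b) monoid_scheme \<Rightarrow> nat \<Rightarrow> (nat set \<Rightarrow> nat) \<Rightarrow> ('g \<Rightarrow> nat \<Rightarrow> nat)
     \<Rightarrow> ('g \<Rightarrow> nat set \<times> nat \<Rightarrow> nat set \<times> nat) \<Rightarrow> bool" where
  "complex_action G n \<Omega> \<phi> \<psi> \<longleftrightarrow>
     group_action G {..n} \<phi> \<and>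
     (\<forall>g\<in>carrier G. \<forall>S. S \<subseteq> {..n} \<longrightarrow> \<Omega> (\<phi> g ` S) = \<Omega> S) \<and>
     group_action G (facet_copies n \<Omega>) \<psi> \<and>
     (\<forall>g\<in>carrier G. \<forall>f\<in>facet_copies n \<Omega>. fst (\<psi> g f) = \<phi> g ` fst f)"

definition free_complex_action ::
  "('g, 'b) monoid_scheme \<Rightarrow> nat \<Rightarrow> (nat set \<Rightarrow> nat) \<Rightarrow> ('g \<Rightarrow> nat \<Rightarrow> nat)
     \<Rightarrow> ('g \<Rightarrow> nat set \<times> nat \<Rightarrow> nat set \<times> nat) \<Rightarrow> bool" where
  "free_complex_action G n \<Omega> \<phi> \<psi> \<longleftrightarrow>
     complex_action G n \<Omega> \<phi> \<psi> \<and>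
     (\<forall>f\<in>facet_copies n \<Omega>. stabilizer G \<psi> f = {\<one>\<^bsub>G\<^esub>})"

section \<open>Polynomials\<close>

text \<open>A polynomial with variables in \<open>'v\<close> is a finitely supported map from monomials
  (exponent vectors) to real coefficients; multiplication is that of the monoid algebra.\<close>

type_synonym 'v rpoly = "('v \<Rightarrow>\<^sub>0 nat) \<Rightarrow>\<^sub>0 real"

definition poly_const :: "real \<Rightarrow> 'v rpoly" where
  "poly_const c = Poly_Mapping.single 0 c"

definition poly_var :: "'v \<Rightarrow> 'v rpoly" where
  "poly_var v = Poly_Mapping.single (Poly_Mapping.single v 1) 1"

definition poly_eval :: "('v \<Rightarrow> real) \<Rightarrow> 'v rpoly \<Rightarrow> real" where
  "poly_eval a p = (\<Sum>t\<in>Poly_Mapping.keys p. Poly_Mapping.lookup p t *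
     (\<Prod>v\<in>Poly_Mapping.keys t. a v ^ Poly_Mapping.lookup t v))"

definition poly_subst :: "('v \<Rightarrow> 'w rpoly) \<Rightarrow> 'v rpoly \<Rightarrow> 'w rpoly" where
  "poly_subst \<sigma> p = (\<Sum>t\<in>Poly_Mapping.keys p. poly_const (Poly_Mapping.lookup p t) *
     (\<Prod>v\<in>Poly_Mapping.keys t. \<sigma> v ^ Poly_Mapping.lookup t v))"

definition polys_in :: "'v set \<Rightarrow> 'v rpoly set" where
  "polys_in V = {p. \<forall>t\<in>Poly_Mapping.keys p. Poly_Mapping.keys t \<subseteq> V}"

text \<open>The pair \<open>(i, k)\<close> stands for the \<open>k\<close>-th variable of the \<open>i\<close>-th block;
  \<open>i\<close> ranges over \<open>{..n}\<close> and \<open>k\<close> over \<open>{..m}\<close>.\<close>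

definition block :: "nat \<Rightarrow> nat \<Rightarrow> (nat \<times> nat) set" where
  "block m i = {i} \<times> {..m}"

definition homogeneous_polys :: "nat \<Rightarrow> nat \<Rightarrow> nat \<Rightarrow> (nat \<times> nat) rpoly set" where
  "homogeneous_polys n m e = {p \<in> polys_in ({..n} \<times> {..m}).
     \<forall>t\<in>Poly_Mapping.keys p. \<forall>i\<le>n. (\<Sum>k\<le>m. Poly_Mapping.lookup t (i, k)) = e}"

text \<open>The substitution of the \<open>j\<close>-th block of variables for any other block.\<close>

definition in_block :: "nat \<Rightarrow> (nat \<times> nat) rpoly \<Rightarrow> (nat \<times> nat) rpoly" where
  "in_block j p = poly_subst (\<lambda>(i, k). poly_var (j, k)) p"

definition sos :: "'v set \<Rightarrow> 'v rpoly \<Rightarrow> bool" where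
  "sos V p \<longleftrightarrow> (\<exists>(r::nat) h. (\<forall>j<r. h j \<in> polys_in V) \<and> p = (\<Sum>j<r. h j ^ 2))"

definition act_poly :: "('g \<Rightarrow> nat \<Rightarrow> nat) \<Rightarrow> 'g \<Rightarrow> (nat \<times> nat) rpoly \<Rightarrow> (nat \<times> nat) rpoly" where
  "act_poly \<phi> g p = poly_subst (\<lambda>(i, k). poly_var (\<phi> g i, k)) p"

definition invariant_poly ::
  "('g, 'b) monoid_scheme \<Rightarrow> ('g \<Rightarrow> nat \<Rightarrow> nat) \<Rightarrow> (nat \<times> nat) rpoly \<Rightarrow> bool" where
  "invariant_poly G \<phi> p \<longleftrightarrow> (\<forall>g\<in>carrier G. act_poly \<phi> g p = p)"

definition separable_poly :: "nat \<Rightarrow> nat \<Rightarrow> (nat \<times> nat) rpoly \<Rightarrow> bool" where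
  "separable_poly n m p \<longleftrightarrow>
     (\<exists>(r::nat) h. (\<forall>j<r. \<forall>i\<le>n. sos (block m i) (h j i)) \<and> p = (\<Sum>j<r. \<Prod>i\<le>n. h j i))"

text \<open>The supremum over the product of \<open>n + 1\<close> Euclidean unit spheres in dimension \<open>m + 1\<close>.
  For \<open>p\<close> in the polynomial ring in the variables \<open>{..n} \<times> {..m}\<close>, only the values
  \<open>a i k\<close> with \<open>i \<le> n\<close> and \<open>k \<le> m\<close> matter.\<close>

definition sup_norm :: "nat \<Rightarrow> nat \<Rightarrow> (nat \<times> nat) rpoly \<Rightarrow> real" where
  "sup_norm n m p = Sup {\<bar>poly_eval (\<lambda>(i, k). a i k) p\<bar> | a. \<forall>i\<le>n. L2_set (a i) {..m} = 1}"

section \<open>Matrices and the gauge\<close>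

text \<open>The rows and columns of a \<open>D \<times> D\<close> matrix are indexed by the \<open>D\<close> monomials of
  degree \<open>d\<close> in \<open>m + 1\<close> variables themselves, which are the same for each tensor factor.
  A matrix in the \<open>(n + 1)\<close>-fold tensor power is indexed by tuples of such monomials.
  Values of a matrix outside its index set are never used.\<close>

definition monomials :: "nat \<Rightarrow> nat \<Rightarrow> (nat \<Rightarrow>\<^sub>0 nat) set" where
  "monomials m d = {t. Poly_Mapping.keys t \<subseteq> {..m} \<and> (\<Sum>k\<le>m. Poly_Mapping.lookup t k) = d}"

lemma card_monomials: "card (monomials m d) = (m + d) choose d"
proof -
  let ?L = "{l::nat list. length l = Suc m \<and> sum_list l = d}"
  have inj: "inj_on Poly_Mapping.nth ?L"
  proof (rule inj_onI)
    fix l l' :: "nat list"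
    assume l: "l \<in> ?L" and l': "l' \<in> ?L" and eq: "Poly_Mapping.nth l = Poly_Mapping.nth l'"
    have "l ! k = l' ! k" if "k < Suc m" for k
      using arg_cong[OF eq, of "\<lambda>t. Poly_Mapping.lookup t k"] l l' that
      by (simp add: nth.rep_eq nth_default_def)
    then show "l = l'" using l l' by (auto intro: nth_equalityI)
  qed
  have "Poly_Mapping.nth ` ?L = monomials m d"
  proof (intro equalityI subsetI)
    fix t assume "t \<in> Poly_Mapping.nth ` ?L"
    then obtain l where l: "length l = Suc m" "sum_list l = d" "t = Poly_Mapping.nth l" by auto
    have "(\<Sum>k\<le>m. Poly_Mapping.lookup t k) = (\<Sum>k<Suc m. l ! k)"
      unfolding lessThan_Suc_atMost
      by (rule sum.cong) (auto simp: l nth.rep_eq nth_default_def)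
    also have "\<dots> = d" using l by (simp add: sum_list_sum_nth atLeast0LessThan)
    finally have "(\<Sum>k\<le>m. Poly_Mapping.lookup t k) = d" .
    moreover have "Poly_Mapping.keys t \<subseteq> {..m}"
      using l by (auto simp: in_keys_iff nth.rep_eq nth_default_def simp del: keys_nth split: if_splits)
    ultimately show "t \<in> monomials m d" by (simp add: monomials_def)
  next
    fix t assume t: "t \<in> monomials m d"
    let ?l = "map (Poly_Mapping.lookup t) [0..<Suc m]"
    have "sum_list ?l = (\<Sum>k<Suc m. Poly_Mapping.lookup t k)"
      by (simp add: sum_list_sum_nth atLeast0LessThan del: upt_Suc)
    also have "\<dots> = d" using t by (simp add: monomials_def lessThan_Suc_atMost)
    finally have "?l \<in> ?L" by (simp del: upt_Suc)
    moreover have "t = Poly_Mapping.nth ?l"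
      using t by (intro poly_mapping_eqI)
        (auto simp: monomials_def nth.rep_eq nth_default_def in_keys_iff not_less simp del: upt_Suc)
    ultimately show "t \<in> Poly_Mapping.nth ` ?L" by blast
  qed
  then have "card (monomials m d) = card ?L"
    using card_image[OF inj] by simp
  then show ?thesis by (simp add: card_length_sum_list add.commute)
qed

definition tuples :: "nat \<Rightarrow> 'x set \<Rightarrow> (nat \<Rightarrow> 'x) set" where
  "tuples n X = ({..n} \<rightarrow>\<^sub>E X)"

definition psd_matrix :: "'x set \<Rightarrow> ('x \<Rightarrow> 'x \<Rightarrow> real) \<Rightarrow> bool" where
  "psd_matrix X A \<longleftrightarrow>
     (\<forall>s\<in>X. \<forall>t\<in>X. A s t = A t s) \<and>
     (\<forall>v. 0 \<le> (\<Sum>s\<in>X. \<Sum>t\<in>X. v s * A s t * v t))"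

definition tensor_matrix ::
  "nat \<Rightarrow> (nat \<Rightarrow> 'x \<Rightarrow> 'x \<Rightarrow> real) \<Rightarrow> (nat \<Rightarrow> 'x) \<Rightarrow> (nat \<Rightarrow> 'x) \<Rightarrow> real" where
  "tensor_matrix n A a b = (\<Prod>i\<le>n. A i (a i) (b i))"

definition separable_matrix ::
  "nat \<Rightarrow> 'x set \<Rightarrow> ((nat \<Rightarrow> 'x) \<Rightarrow> (nat \<Rightarrow> 'x) \<Rightarrow> real) \<Rightarrow> bool" where
  "separable_matrix n X M \<longleftrightarrow>
     (\<exists>(r::nat) A. (\<forall>j<r. \<forall>i\<le>n. psd_matrix X (A j i)) \<and>
        (\<forall>a\<in>tuples n X. \<forall>b\<in>tuples n X. M a b = (\<Sum>j<r. tensor_matrix n (A j) a b)))"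

definition matrix_trace ::
  "nat \<Rightarrow> 'x set \<Rightarrow> ((nat \<Rightarrow> 'x) \<Rightarrow> (nat \<Rightarrow> 'x) \<Rightarrow> real) \<Rightarrow> real" where
  "matrix_trace n X M = (\<Sum>a\<in>tuples n X. M a a)"

definition SEP :: "nat \<Rightarrow> 'x set \<Rightarrow> ((nat \<Rightarrow> 'x) \<Rightarrow> (nat \<Rightarrow> 'x) \<Rightarrow> real) set" where
  "SEP n X = {M. separable_matrix n X M \<and> matrix_trace n X M \<le> 1}"

text \<open>Reindexing rows and columns along \<open>g\<close> maps \<open>tensor_matrix n A\<close> to the tensor product
  of the same factors permuted by the inverse of \<open>g\<close>; the inverse is immaterial as \<open>g\<close>
  ranges over the whole group.\<close>

definition invariant_matrix ::
  "('g, 'b) monoid_scheme \<Rightarrow> nat \<Rightarrow> ('g \<Rightarrow> nat \<Rightarrow> nat) \<Rightarrow> 'x set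
     \<Rightarrow> ((nat \<Rightarrow> 'x) \<Rightarrow> (nat \<Rightarrow> 'x) \<Rightarrow> real) \<Rightarrow> bool" where
  "invariant_matrix G n \<phi> X M \<longleftrightarrow>
     (\<forall>g\<in>carrier G. \<forall>a\<in>tuples n X. \<forall>b\<in>tuples n X.
        M (\<lambda>i\<in>{..n}. a (\<phi> g i)) (\<lambda>i\<in>{..n}. b (\<phi> g i)) = M a b)"

text \<open>The entry at \<open>a\<close> of the tensor product of the monomial vectors.\<close>

definition monomial_entry :: "nat \<Rightarrow> nat \<Rightarrow> (nat \<Rightarrow> (nat \<Rightarrow>\<^sub>0 nat)) \<Rightarrow> (nat \<times> nat) rpoly" where
  "monomial_entry n m a = (\<Prod>i\<le>n. \<Prod>k\<le>m. poly_var (i, k) ^ Poly_Mapping.lookup (a i) k)"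

definition gram_map ::
  "nat \<Rightarrow> nat \<Rightarrow> nat \<Rightarrow> ((nat \<Rightarrow> (nat \<Rightarrow>\<^sub>0 nat)) \<Rightarrow> (nat \<Rightarrow> (nat \<Rightarrow>\<^sub>0 nat)) \<Rightarrow> real)
     \<Rightarrow> (nat \<times> nat) rpoly" where
  "gram_map n m d M = (\<Sum>a\<in>tuples n (monomials m d). \<Sum>b\<in>tuples n (monomials m d).
     monomial_entry n m a * poly_const (M a b) * monomial_entry n m b)"

text \<open>For \<open>p\<close> separable, invariant and homogeneous of degree \<open>2 * d\<close> in each block the set
  is nonempty; otherwise the infimum may be taken over the empty set and is then
  unspecified.\<close>

definition sep_gauge ::
  "('g, 'b) monoid_scheme \<Rightarrow> nat \<Rightarrow> nat \<Rightarrow> nat \<Rightarrow> ('g \<Rightarrow> nat \<Rightarrow> nat) \<Rightarrow> (nat \<times> nat) rpoly \<Rightarrow> real" where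
  "sep_gauge G n m d \<phi> p = Inf {l. l > 0 \<and> (\<exists>M\<in>SEP n (monomials m d).
     invariant_matrix G n \<phi> (monomials m d) M \<and> p = poly_const l * gram_map n m d M)}"

section \<open>Separable decompositions and the separable rank\<close>

definition translate_index ::
  "('g, 'b) monoid_scheme \<Rightarrow> nat \<Rightarrow> (nat set \<Rightarrow> nat) \<Rightarrow> ('g \<Rightarrow> nat \<Rightarrow> nat)
     \<Rightarrow> ('g \<Rightarrow> nat set \<times> nat \<Rightarrow> nat set \<times> nat) \<Rightarrow> 'g \<Rightarrow> nat
     \<Rightarrow> (nat set \<times> nat \<Rightarrow> 'k) \<Rightarrow> (nat set \<times> nat \<Rightarrow> 'k)" where
  "translate_index G n \<Omega> \<phi> \<psi> g i \<beta> = (\<lambda>f\<in>facet_copies_at n \<Omega> (\<phi> g i). \<beta> (\<psi> (inv\<^bsub>G\<^esub> g) f))"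

definition separable_decomposition ::
  "('g, 'b) monoid_scheme \<Rightarrow> nat \<Rightarrow> nat \<Rightarrow> (nat set \<Rightarrow> nat) \<Rightarrow> ('g \<Rightarrow> nat \<Rightarrow> nat)
     \<Rightarrow> ('g \<Rightarrow> nat set \<times> nat \<Rightarrow> nat set \<times> nat) \<Rightarrow> 'k set
     \<Rightarrow> (nat \<Rightarrow> (nat set \<times> nat \<Rightarrow> 'k) \<Rightarrow> (nat \<times> nat) rpoly) \<Rightarrow> (nat \<times> nat) rpoly \<Rightarrow> bool" where
  "separable_decomposition G n m \<Omega> \<phi> \<psi> I h q \<longleftrightarrow>
     finite I \<and>
     (\<forall>i\<le>n. \<forall>\<beta>\<in>facet_copies_at n \<Omega> i \<rightarrow>\<^sub>E I. sos (block m i) (h i \<beta>)) \<and>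
     q = (\<Sum>\<alpha>\<in>facet_copies n \<Omega> \<rightarrow>\<^sub>E I. \<Prod>i\<le>n. h i (restrict \<alpha> (facet_copies_at n \<Omega> i))) \<and>
     (\<forall>g\<in>carrier G. \<forall>i\<le>n. \<forall>\<beta>\<in>facet_copies_at n \<Omega> i \<rightarrow>\<^sub>E I.
        h i \<beta> = in_block i (h (\<phi> g i) (translate_index G n \<Omega> \<phi> \<psi> g i \<beta>)))"

text \<open>Every finite index set is in bijection with a set of natural numbers, so index sets of
  type \<open>nat\<close> suffice. The infimum of the empty set is \<open>\<infinity>\<close>.\<close>

definition sep_rank ::
  "('g, 'b) monoid_scheme \<Rightarrow> nat \<Rightarrow> nat \<Rightarrow> (nat set \<Rightarrow> nat) \<Rightarrow> ('g \<Rightarrow> nat \<Rightarrow> nat)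
     \<Rightarrow> ('g \<Rightarrow> nat set \<times> nat \<Rightarrow> nat set \<times> nat) \<Rightarrow> (nat \<times> nat) rpoly \<Rightarrow> enat" where
  "sep_rank G n m \<Omega> \<phi> \<psi> q =
     Inf {enat (card I) | (I :: nat set) h. separable_decomposition G n m \<Omega> \<phi> \<psi> I h q}"

end

theory Submission
  imports Defs
begin

text \<open>Separable matrices of trace at most 1 are convex combinations of zero and of tensor products of
  positive semidefinite matrices of trace 1. The latter have Frobenius norm at most 1, so Maurey's
  argument approximates a separable matrix by an average of \<open>k\<close> products up to an error of
  \<open>1 / sqrt k\<close> in the Frobenius norm, and this norm dominates the sup norm on spheres of the
  associated polynomial. Averaging the resulting polynomial over \<open>G\<close> does not increase the
  distance to the invariant \<open>p\<close>, and freeness and connectedness turn an orbit average of \<open>k\<close>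
  products into a decomposition with \<open>k * |G|\<close> indices. The spare
  factor \<open>8 * exp 4\<close> leaves room for a feasible \<open>l\<close> below twice the gauge. The gauge itself
  is meaningful because \<open>p\<close> has a separable Gram matrix, by a degree argument.\<close>

section \<open>Evaluation of polynomials\<close>

text \<open>The greedy choice in Maurey's argument takes no account of the group, so the selected
  average need not be invariant. Symmetrising it afterwards multiplies the number of products by
  \<open>|G|\<close>, which is the second factor of the bound.

  A decomposition ties together the local polynomials at all vertices of an orbit, whereas the
  factors of a single product may differ from vertex to vertex. The group element in an index breaks
  this symmetry: it tells each vertex which factor of the product to use.

  A homogeneous \<open>p\<close> may be separable through factors that are not homogeneous, while a
  Gram matrix only sees monomials of degree exactly \<open>d\<close>. The degree argument is
  possible because all summands are nonnegative at every point, so none of them can exceed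
  \<open>p\<close>.

  The infimum in the gauge need not be attained, and it could be zero. In that case the rank bound
  is zero and leaves only \<open>q = 0\<close>; feasible \<open>l\<close> close to zero, together
  with a uniform bound on Gram maps of \<open>SEP\<close>, show that \<open>p\<close> is then small
  enough.\<close>

definition monom_eval :: "('v \<Rightarrow> real) \<Rightarrow> ('v \<Rightarrow>\<^sub>0 nat) \<Rightarrow> real" where
  "monom_eval a t = (\<Prod>v\<in>Poly_Mapping.keys t. a v ^ Poly_Mapping.lookup t v)"

lemma monom_eval_superset:
  assumes "finite V" "Poly_Mapping.keys t \<subseteq> V"
  shows "monom_eval a t = (\<Prod>v\<in>V. a v ^ Poly_Mapping.lookup t v)"
  unfolding monom_eval_def using assms
  by (intro prod.mono_neutral_left) (auto simp: in_keys_iff)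

lemma monom_eval_add: "monom_eval a (s + t) = monom_eval a s * monom_eval a t"
proof -
  let ?V = "Poly_Mapping.keys s \<union> Poly_Mapping.keys t"
  have "Poly_Mapping.keys (s + t) \<subseteq> ?V" by (rule Poly_Mapping.keys_add)
  then show ?thesis
    by (simp add: monom_eval_superset[of ?V] lookup_add power_add prod.distrib)
qed

lemma poly_eval_superset:
  assumes "finite T" "Poly_Mapping.keys p \<subseteq> T"
  shows "poly_eval a p = (\<Sum>t\<in>T. Poly_Mapping.lookup p t * monom_eval a t)"
  unfolding poly_eval_def monom_eval_def[symmetric] using assms
  by (intro sum.mono_neutral_left) (auto simp: in_keys_iff)

lemma poly_eval_add: "poly_eval a (p + q) = poly_eval a p + poly_eval a q"
proof -
  let ?T = "Poly_Mapping.keys p \<union> Poly_Mapping.keys q"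
  have "Poly_Mapping.keys (p + q) \<subseteq> ?T" by (rule Poly_Mapping.keys_add)
  then show ?thesis
    by (simp add: poly_eval_superset[of ?T] lookup_add distrib_right sum.distrib)
qed

lemma poly_eval_0 [simp]: "poly_eval a 0 = 0"
  by (simp add: poly_eval_def)

lemma poly_eval_minus: "poly_eval a (p - q) = poly_eval a p - poly_eval a q"
  using poly_eval_add[of a "p - q" q] by simp

lemma poly_eval_sum: "poly_eval a (\<Sum>x\<in>A. f x) = (\<Sum>x\<in>A. poly_eval a (f x))"
  by (induction A rule: infinite_finite_induct) (auto simp: poly_eval_add)

lemma poly_eval_single: "poly_eval a (Poly_Mapping.single t c) = c * monom_eval a t"
  by (subst poly_eval_superset[of "{t}"]) auto

lemma poly_mapping_decompose: 
  "p = (\<Sum>t\<in>Poly_Mapping.keys p. Poly_Mapping.single t (Poly_Mapping.lookup p t))"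
  by (rule poly_mapping_eqI)
    (auto simp: lookup_sum lookup_single when_def in_keys_iff)

lemma poly_eval_mult: "poly_eval a (p * q) = poly_eval a p * poly_eval a q"
proof -
  have "p * q = (\<Sum>s\<in>Poly_Mapping.keys p. \<Sum>t\<in>Poly_Mapping.keys q.
      Poly_Mapping.single (s + t) (Poly_Mapping.lookup p s * Poly_Mapping.lookup q t))"
    by (subst (1) poly_mapping_decompose[of p], subst (1) poly_mapping_decompose[of q])
      (simp add: sum_product mult_single)
  then have "poly_eval a (p * q) = (\<Sum>s\<in>Poly_Mapping.keys p. \<Sum>t\<in>Poly_Mapping.keys q.
     (Poly_Mapping.lookup p s * monom_eval a s) * (Poly_Mapping.lookup q t * monom_eval a t))"
    by (simp add: poly_eval_sum poly_eval_single monom_eval_add mult_ac)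
  then show ?thesis
    by (simp add: sum_product poly_eval_superset[OF finite_keys order_refl])
qed

lemma poly_eval_const [simp]: "poly_eval a (poly_const c) = c"
  by (simp add: poly_const_def poly_eval_single monom_eval_def)

lemma poly_eval_1 [simp]: "poly_eval a 1 = 1"
  using poly_eval_const[of a 1] by (simp add: poly_const_def)

lemma poly_eval_var [simp]: "poly_eval a (poly_var v) = a v"
  by (simp add: poly_var_def poly_eval_single monom_eval_superset[of "{v}"])

lemma poly_eval_prod: "poly_eval a (\<Prod>x\<in>A. f x) = (\<Prod>x\<in>A. poly_eval a (f x))"
  by (induction A rule: infinite_finite_induct) (auto simp: poly_eval_mult)

lemma poly_eval_power: "poly_eval a (p ^ k) = poly_eval a p ^ k"
  by (induction k) (auto simp: poly_eval_mult)

lemmas poly_eval_hom = poly_eval_add poly_eval_minus poly_eval_sum poly_eval_mult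
  poly_eval_prod poly_eval_power

lemma poly_eval_subst: "poly_eval a (poly_subst \<sigma> p) = poly_eval (\<lambda>v. poly_eval a (\<sigma> v)) p"
  by (simp add: poly_subst_def poly_eval_hom) (simp add: poly_eval_def)

text \<open>With all variables but \<open>w\<close> fixed, the sum is a univariate real polynomial
  in \<open>w\<close> that vanishes everywhere, so each coefficient vanishes; the one at
  \<open>t w\<close> is an instance over \<open>V\<close>. The exponents in this instance agree at
  \<open>w\<close>, which is why injectivity of the restrictions passes on to them.\<close>

lemma vanishing_monomial_sum:
  fixes c :: "('v \<Rightarrow> nat) \<Rightarrow> real"
  assumes "finite V" "finite T" "inj_on (\<lambda>t. restrict t V) T"
    and "\<And>a. (\<Sum>t\<in>T. c t * (\<Prod>v\<in>V. a v ^ t v)) = 0" and "t \<in> T"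
  shows "c t = 0"
  using assms
proof (induction V arbitrary: T t rule: finite_induct)
  case empty
  then have "T = {t}" by (auto simp: inj_on_def)
  then show ?case using empty by simp
next
  case (insert w V)
  define P where "P a = (\<Sum>s\<in>T. monom (c s * (\<Prod>v\<in>V. a v ^ s v)) (s w))" for a :: "'v \<Rightarrow> real"
  have "poly (P a) x = 0" for a x
  proof -
    have "(\<Prod>v\<in>V. (a(w := x)) v ^ s v) = (\<Prod>v\<in>V. a v ^ s v)" for s :: "'v \<Rightarrow> nat"
      using insert.hyps by (intro prod.cong) auto
    then show ?thesis
      using insert.prems(3)[of "a(w := x)"] insert.hyps
      by (simp add: P_def poly_sum poly_monom mult_ac)
  qed
  then have P0: "P a = 0" for a
    by (simp add: poly_eq_poly_eq_iff[symmetric] fun_eq_iff)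
  let ?T = "{s \<in> T. s w = t w}"
  have "(\<Sum>s\<in>?T. c s * (\<Prod>v\<in>V. a v ^ s v)) = 0" for a
  proof -
    have "0 = coeff (P a) (t w)" by (simp add: P0)
    also have "\<dots> = (\<Sum>s\<in>T. if s w = t w then c s * (\<Prod>v\<in>V. a v ^ s v) else 0)"
      by (simp add: P_def coeff_sum)
    also have "\<dots> = (\<Sum>s\<in>?T. c s * (\<Prod>v\<in>V. a v ^ s v))"
      using insert.prems by (simp add: sum.inter_filter)
    finally show ?thesis by simp
  qed
  moreover have "inj_on (\<lambda>s. restrict s V) ?T"
  proof (rule inj_onI)
    fix s s' assume s: "s \<in> ?T" "s' \<in> ?T" "restrict s V = restrict s' V"
    then have "restrict s (insert w V) = restrict s' (insert w V)"
      by (auto simp: fun_eq_iff restrict_def) metis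
    then show "s = s'" using inj_onD[OF insert.prems(2)] s by blast
  qed
  moreover have "finite ?T" "t \<in> ?T" using insert.prems(1,4) by auto
  ultimately show ?case
    by (intro insert.IH[of ?T t])
qed

lemma poly_eval_eq_0:
  assumes "\<And>a. poly_eval a p = 0"
  shows "p = 0"
proof (rule poly_mapping_eqI)
  fix t
  let ?V = "\<Union>s\<in>Poly_Mapping.keys p. Poly_Mapping.keys s"
  let ?T = "Poly_Mapping.lookup ` Poly_Mapping.keys p"
  have inj: "inj_on Poly_Mapping.lookup A" for A :: "('a \<Rightarrow>\<^sub>0 nat) set"
    by (auto intro: inj_onI simp: lookup_inject)
  have "Poly_Mapping.lookup p s = 0" if s: "s \<in> Poly_Mapping.keys p" for s
  proof -
    \<comment> \<open>The vanishing lemma speaks about plain exponent functions, so the coefficients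
      are transported along the injection \<open>Poly_Mapping.lookup\<close>.\<close>
    let ?c = "\<lambda>f. Poly_Mapping.lookup p (the_inv_into UNIV Poly_Mapping.lookup f)"
    have c: "?c (Poly_Mapping.lookup u) = Poly_Mapping.lookup p u" for u
      by (simp add: the_inv_into_f_f[OF inj])
    have "?c (Poly_Mapping.lookup s) = 0"
    proof (rule vanishing_monomial_sum[of ?V ?T])
      show "inj_on (\<lambda>t. restrict t ?V) ?T"
      proof (rule inj_onI, clarify)
        fix u u' assume u: "u \<in> Poly_Mapping.keys p" "u' \<in> Poly_Mapping.keys p"
          "restrict (Poly_Mapping.lookup u) ?V = restrict (Poly_Mapping.lookup u') ?V"
        have "Poly_Mapping.lookup u x = Poly_Mapping.lookup u' x" for x
        proof (cases "x \<in> ?V")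
          case True
          then show ?thesis using fun_cong[OF u(3), of x] by simp
        next
          case False
          then show ?thesis using u by (auto simp: in_keys_iff)
        qed
        then show "Poly_Mapping.lookup u = Poly_Mapping.lookup u'" by (rule ext)
      qed
      fix a :: "'a \<Rightarrow> real"
      have "0 = poly_eval a p" by (simp add: assms)
      also have "\<dots> = (\<Sum>u\<in>Poly_Mapping.keys p. Poly_Mapping.lookup p u * monom_eval a u)"
        by (simp add: poly_eval_superset)
      also have "\<dots> = (\<Sum>u\<in>Poly_Mapping.keys p. ?c (Poly_Mapping.lookup u) *
          (\<Prod>v\<in>?V. a v ^ Poly_Mapping.lookup u v))"
        by (intro sum.cong refl, subst monom_eval_superset[of ?V]) (auto simp: c)
      also have "\<dots> = (\<Sum>f\<in>?T. ?c f * (\<Prod>v\<in>?V. a v ^ f v))"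
        by (simp add: sum.reindex[OF inj])
      finally show "(\<Sum>f\<in>?T. ?c f * (\<Prod>v\<in>?V. a v ^ f v)) = 0" by simp
    qed (use s in auto)
    then show ?thesis by (simp add: c)
  qed
  then show "Poly_Mapping.lookup p t = Poly_Mapping.lookup 0 t"
    by (metis in_keys_iff lookup_zero)
qed

text \<open>This reduces identities between polynomials, including those with substitutions, to
  arithmetic of real numbers.\<close>

lemma poly_eval_inject: "(\<And>a. poly_eval a p = poly_eval a q) \<Longrightarrow> p = q"
  using poly_eval_eq_0[of "p - q"] by (simp add: poly_eval_minus)

section \<open>Positive semidefinite and separable matrices\<close>

text \<open>By induction on \<open>X\<close>: \<open>B\<close> is the Schur complement of the diagonal entry at \<open>x\<close>. If that entry
  vanishes, so does its whole row, which agrees with division by zero giving zero.\<close>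

lemma psd_matrix_gram:
  assumes "finite X" "psd_matrix X A"
  shows "\<exists>(r::nat) v. \<forall>s\<in>X. \<forall>t\<in>X. A s t = (\<Sum>l<r. v l s * v l t)"
  using assms
proof (induction X arbitrary: A rule: finite_induct)
  case empty
  then show ?case by auto
next
  case (insert x X)
  note fin = insert.hyps(1) and x = insert.hyps(2)
  have sym: "A s t = A t s" if "s \<in> insert x X" "t \<in> insert x X" for s t
    using insert.prems that by (auto simp: psd_matrix_def)
  \<comment> \<open>The quadratic form of \<open>A\<close> at the vector with entry \<open>y\<close>
    at \<open>x\<close> and entries \<open>w\<close> on \<open>X\<close>, viewed as a quadratic
    polynomial in \<open>y\<close>.\<close>
  have Q: "0 \<le> A x x * y\<^sup>2 + 2 * y * (\<Sum>t\<in>X. A x t * w t) + (\<Sum>s\<in>X. \<Sum>t\<in>X. w s * A s t * w t)" for y w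
  proof -
    let ?v = "\<lambda>s. if s = x then y else w s"
    have e: "?v s = w s" if "s \<in> X" for s using that x by auto
    have "0 \<le> (\<Sum>s\<in>insert x X. \<Sum>t\<in>insert x X. ?v s * A s t * ?v t)"
      by (rule spec[OF conjunct2[OF insert.prems[unfolded psd_matrix_def]], of ?v])
    also have "\<dots> = y * A x x * y + (\<Sum>t\<in>X. y * A x t * ?v t) + (\<Sum>s\<in>X. ?v s * A s x * y) + (\<Sum>s\<in>X.
      \<Sum>t\<in>X. ?v s * A s t * ?v t)"
      using fin x by (simp add: sum.distrib)
    also have "(\<Sum>t\<in>X. y * A x t * ?v t) = y * (\<Sum>t\<in>X. A x t * w t)"
      by (simp add: sum_distrib_left e mult_ac cong: sum.cong)
    also have "(\<Sum>s\<in>X. ?v s * A s x * y) = y * (\<Sum>t\<in>X. A x t * w t)"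
      unfolding sum_distrib_left by (rule sum.cong) (auto simp: e sym[of _ x])
    also have "(\<Sum>s\<in>X. \<Sum>t\<in>X. ?v s * A s t * ?v t) = (\<Sum>s\<in>X. \<Sum>t\<in>X. w s * A s t * w t)"
      by (intro sum.cong refl) (auto simp: e)
    finally show ?thesis by (simp add: power2_eq_square algebra_simps)
  qed
  have nonneg: "0 \<le> A x x" using Q[of 1 "\<lambda>_. 0"] by simp
  define B where "B s t = A s t - A x s * A x t / A x x" for s t
  have "psd_matrix X B" unfolding psd_matrix_def
  proof (intro conjI ballI allI)
    fix s t assume "s \<in> X" "t \<in> X" then show "B s t = B t s" by (simp add: B_def sym[of s t])
  next
    fix w
    let ?b = "\<Sum>t\<in>X. A x t * w t"
    have "(\<Sum>s\<in>X. \<Sum>t\<in>X. w s * B s t * w t) = (\<Sum>s\<in>X. \<Sum>t\<in>X. w s * A s t * w t) 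
       - (\<Sum>s\<in>X. \<Sum>t\<in>X. (A x s * w s) * (A x t * w t) / A x x)"
      by (simp add: B_def sum_subtractf[symmetric] algebra_simps)
    also have "(\<Sum>s\<in>X. \<Sum>t\<in>X. (A x s * w s) * (A x t * w t) / A x x) = ?b * ?b / A x x"
      by (simp add: sum_product sum_divide_distrib)
    \<comment> \<open>The Schur complement is the value of \<open>Q\<close> at its minimising point
      \<open>y = - ?b / A x x\<close>.\<close>
    also have "(\<Sum>s\<in>X. \<Sum>t\<in>X. w s * A s t * w t) - ?b * ?b / A x x =
      A x x * (- ?b / A x x)\<^sup>2 + 2 * (- ?b / A x x) * ?b + (\<Sum>s\<in>X. \<Sum>t\<in>X. w s * A s t * w t)"
      by (cases "A x x = 0") (auto simp: power2_eq_square field_simps)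
    finally show "0 \<le> (\<Sum>s\<in>X. \<Sum>t\<in>X. w s * B s t * w t)"
      by (simp only: Q)
  qed
  from insert.IH[OF this] obtain r :: nat and v where
    v: "\<And>s t. s \<in> X \<Longrightarrow> t \<in> X \<Longrightarrow> B s t = (\<Sum>l<r. v l s * v l t)" by blast
  have zero: "A x t = 0" if "A x x = 0" "t \<in> insert x X" for t
  proof (cases "t = x")
    case False
    then have t: "t \<in> X" using that by auto
    define w where "w = (\<lambda>s. if s = t then 1 else 0 :: real)"
    have b: "(\<Sum>s\<in>X. A x s * w s) = A x t"
      using fin t by (simp add: w_def if_distrib cong: if_cong)
    let ?K = "\<Sum>s\<in>X. \<Sum>t\<in>X. w s * A s t * w t"
    show ?thesis
    proof (rule ccontr)
      assume "A x t \<noteq> 0"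
      \<comment> \<open>With \<open>A x x = 0\<close> the form is affine in \<open>y\<close> with
        slope \<open>2 * A x t\<close>; at this \<open>y\<close> it equals
        \<open>-1\<close>.\<close>
      then show False using Q[of "- (?K + 1) / (2 * A x t)" w] that(1) b by (simp add: field_simps)
    qed
  qed (use that in simp)
  \<comment> \<open>One step of a Cholesky factorisation: the vectors for \<open>B\<close> are
    extended by zero at \<open>x\<close>, and the new vector with index \<open>r\<close> is the row
    of the pivot divided by its square root.\<close>
  define v' where "v' l s = (if l < r then if s
    = x then 0 else v l s else A x s / sqrt (A x x))" for l s
  have "A s t = (\<Sum>l<Suc r. v' l s * v' l t)" if "s \<in> insert x X" "t \<in> insert x X" for s t
  proof -
    have *: "(\<Sum>l<Suc r. v' l s * v' l t) = (\<Sum>l<r. (if s = x then 0 else v l s) * (if t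
      = x then 0 else v l t))
      + A x s * A x t / A x x" 
      using nonneg by (simp add: v'_def)
    show ?thesis
    proof (cases "s = x \<or> t = x")
      case True
      then have "(\<Sum>l<r. (if s = x then 0 else v l s) * (if t = x then 0 else v l t)) = 0" by auto
      then show ?thesis using * True zero that sym by (cases "A x x = 0") auto
    next
      case False
      then show ?thesis using that v[of s t] * by (simp add: B_def)
    qed
  qed
  then show ?case by blast
qed

lemma psd_matrix_diag_nonneg:
  assumes "finite X" "psd_matrix X A" "s \<in> X"
  shows "0 \<le> A s s"
proof -
  obtain r :: nat and v where "\<forall>s\<in>X. \<forall>t\<in>X. A s t = (\<Sum>l<r. v l s * v l t)"
    using psd_matrix_gram[OF assms(1,2)] by blast
  then show ?thesis using assms(3) by (auto intro: sum_nonneg)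
qed

lemma psd_matrix_entry_bound:
  assumes "finite X" "psd_matrix X A" "s \<in> X" "t \<in> X"
  shows "(A s t)\<^sup>2 \<le> A s s * A t t"
proof -
  obtain r :: nat and v where v: "\<forall>s\<in>X. \<forall>t\<in>X. A s t = (\<Sum>l<r. v l s * v l t)"
    using psd_matrix_gram[OF assms(1,2)] by blast
  have "(\<Sum>l<r. v l s * v l t)\<^sup>2 \<le> (\<Sum>l<r. (v l s)\<^sup>2) * (\<Sum>l<r. (v l t)\<^sup>2)"
    by (rule Cauchy_Schwarz_ineq_sum)
  then show ?thesis using v assms(3,4) by (simp add: power2_eq_square)
qed

lemma finite_monomials [simp]: "finite (monomials m d)"
  by (rule card_ge_0_finite) (simp add: card_monomials)

lemma finite_tuples [simp]: "finite X \<Longrightarrow> finite (tuples n X)"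
  by (simp add: tuples_def finite_PiE)

text \<open>The inequality for \<open>2 x 2\<close> minors holds in each factor and hence for the
  product. Summing the products of two diagonal entries over all pairs gives the square of the
  trace.\<close>

lemma tensor_matrix_frobenius:
  assumes X: "finite X" and A: "\<And>i. i \<le> n \<Longrightarrow> psd_matrix X (A i)"
  shows "(\<Sum>a\<in>tuples n X. \<Sum>b\<in>tuples n X. (tensor_matrix n A a b)\<^sup>2)
     \<le> (matrix_trace n X (tensor_matrix n A))\<^sup>2"
proof -
  have "(tensor_matrix n A a b)\<^sup>2 \<le> tensor_matrix n A a a * tensor_matrix n A b b"
    if "a \<in> tuples n X" "b \<in> tuples n X" for a b
    using that psd_matrix_entry_bound[OF X A] unfolding tensor_matrix_def tuples_def
    by (simp only: prod_power_distrib flip: prod.distrib)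
      (intro prod_mono, auto simp: PiE_iff)
  then have "(\<Sum>a\<in>tuples n X. \<Sum>b\<in>tuples n X. (tensor_matrix n A a b)\<^sup>2) 
    \<le> (\<Sum>a\<in>tuples n X. \<Sum>b\<in>tuples n X. tensor_matrix n A a a * tensor_matrix n A b b)"
    by (intro sum_mono)
  then show ?thesis by (simp add: matrix_trace_def power2_eq_square sum_product)
qed

lemma tensor_matrix_trace_nonneg:
  assumes X: "finite X" and A: "\<And>i. i \<le> n \<Longrightarrow> psd_matrix X (A i)"
  shows "0 \<le> matrix_trace n X (tensor_matrix n A)"
  unfolding matrix_trace_def tensor_matrix_def tuples_def
  by (intro sum_nonneg prod_nonneg) (auto simp: PiE_iff intro!: psd_matrix_diag_nonneg[OF X A])

text \<open>It serves two purposes: a product of trace zero vanishes, so it can be normalised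
  without loss, and the entries of matrices in \<open>SEP\<close> are uniformly bounded.\<close>

lemma tensor_matrix_entry_le_trace:
  assumes X: "finite X" and A: "\<And>i. i \<le> n \<Longrightarrow> psd_matrix X (A i)"
    and ab: "a \<in> tuples n X" "b \<in> tuples n X"
  shows "\<bar>tensor_matrix n A a b\<bar> \<le> matrix_trace n X (tensor_matrix n A)"
proof -
  let ?T = "tuples n X"
  have "(tensor_matrix n A a b)\<^sup>2 \<le> (\<Sum>b\<in>?T. (tensor_matrix n A a b)\<^sup>2)"
    using X ab by (intro member_le_sum) auto
  also have "\<dots> \<le> (\<Sum>a\<in>?T. \<Sum>b\<in>?T. (tensor_matrix n A a b)\<^sup>2)"
    using X ab by (intro member_le_sum[of a ?T "\<lambda>a. \<Sum>b\<in>?T. (tensor_matrix n A a b)\<^sup>2"]) (auto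
      intro!: sum_nonneg)
  also have "\<dots> \<le> (matrix_trace n X (tensor_matrix n A))\<^sup>2"
    by (rule tensor_matrix_frobenius[OF X A])
  finally have "\<bar>tensor_matrix n A a b\<bar> \<le> \<bar>matrix_trace n X (tensor_matrix n A)\<bar>"
    by (simp only: abs_le_square_iff)
  then show ?thesis using tensor_matrix_trace_nonneg[OF X A] by simp
qed

section \<open>Approximation of convex combinations in a Hilbert space\<close>

text \<open>The average of the squared norm of \<open>S + v j - M\<close> over \<open>j\<close> exceeds that of \<open>S\<close> by the variance of
  \<open>v\<close>, which is at most 1; so some \<open>j\<close> does not do worse.\<close>

lemma maurey_greedy:
  fixes v :: "'j \<Rightarrow> 'e \<Rightarrow> real"
  assumes E: "finite E" and J: "finite J" and w: "\<And>j. j \<in> J \<Longrightarrow> 0 \<le> w j" and w1: "(\<Sum>j\<in>J. w j) = 1"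
    and M: "\<And>e. e \<in> E \<Longrightarrow> M e = (\<Sum>j\<in>J. w j * v j e)"
    and v: "\<And>j. j \<in> J \<Longrightarrow> (\<Sum>e\<in>E. (v j e)\<^sup>2) \<le> 1"
  shows "\<exists>f. (\<forall>l<k. f l \<in> J) \<and> (\<Sum>e\<in>E. (\<Sum>l<(k::nat). v (f l) e - M e)\<^sup>2) \<le> real k"
proof (induction k)
  case 0
  then show ?case by simp
next
  case (Suc k)
  then obtain f where f: "\<forall>l<k. f l \<in> J" and S: "(\<Sum>e\<in>E. (\<Sum>l<k. v (f l) e - M e)\<^sup>2) \<le> real k"
    by blast
  define S where "S e = (\<Sum>l<k. v (f l) e - M e)" for e
  have "(\<Sum>j\<in>J. w j * (\<Sum>e\<in>E. (S e + (v j e - M e))\<^sup>2))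
     = (\<Sum>e\<in>E. \<Sum>j\<in>J. w j * (S e - M e)\<^sup>2 + 2 * (S e - M e) * (w j * v j e) + w j * (v j e)\<^sup>2)"
    unfolding sum_distrib_left
    by (subst sum.swap) (simp add: power2_eq_square algebra_simps)
  also have "\<dots> = (\<Sum>e\<in>E. (S e - M e)\<^sup>2 + 2 * (S e - M e) * M e + (\<Sum>j\<in>J. w j * (v j e)\<^sup>2))"
    by (intro sum.cong refl) 
      (simp add: sum.distrib w1 M sum_distrib_left[symmetric] sum_distrib_right[symmetric])
  \<comment> \<open>The average of \<open>v j\<close> is \<open>M\<close>, and
    \<open>(S - M)^2 + 2 * (S - M) * M = S^2 - M^2\<close>.\<close>
  also have "\<dots> = (\<Sum>e\<in>E. (S e)\<^sup>2) - (\<Sum>e\<in>E. (M e)\<^sup>2) + (\<Sum>j\<in>J. w j * (\<Sum>e\<in>E. (v j e)\<^sup>2))"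
    unfolding sum_distrib_left sum.distrib sum.swap[of _ J E]
    by (simp add: power2_eq_square algebra_simps sum.distrib sum_subtractf sum_distrib_left)
  also have "\<dots> \<le> real k - 0 + (\<Sum>j\<in>J. w j * 1)"
    using S v w by (intro add_mono diff_mono sum_mono mult_left_mono sum_nonneg) (auto simp: S_def)
  also have "\<dots> = (\<Sum>j\<in>J. w j * real (Suc k))"
    by (simp add: w1 sum_distrib_right[symmetric])
  finally have le: "(\<Sum>j\<in>J. w j * (\<Sum>e\<in>E. (S e + (v j e - M e))\<^sup>2)) \<le> (\<Sum>j\<in>J. w j * real (Suc k))" .
  have "\<exists>j\<in>J. (\<Sum>e\<in>E. (S e + (v j e - M e))\<^sup>2) \<le> real (Suc k)"
  proof (rule ccontr)
    assume "\<not> ?thesis"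
    then have gt: "\<And>j. j \<in> J \<Longrightarrow> real (Suc k) < (\<Sum>e\<in>E. (S e + (v j e - M e))\<^sup>2)" by force
    \<comment> \<open>The comparison of the weighted sums is strict only if some index has positive
      weight.\<close>
    obtain j where j: "j \<in> J" "w j > 0"
      using w1 w by (metis le_less sum.neutral zero_neq_one)
    have "(\<Sum>j\<in>J. w j * real (Suc k)) < (\<Sum>j\<in>J. w j * (\<Sum>e\<in>E. (S e + (v j e - M e))\<^sup>2))"
      using J j gt w by (intro sum_strict_mono_ex1) 
       (auto intro!: mult_left_mono mult_strict_left_mono bexI[of _ j] dest: less_imp_le)
    with le show False by simp
  qed
  then obtain j where j: "j \<in> J" "(\<Sum>e\<in>E. (S e + (v j e - M e))\<^sup>2) \<le> real (Suc k)" by blast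
  show ?case
    using f j by (intro exI[of _ "f(k := j)"]) (auto simp: S_def less_Suc_eq)
qed

section \<open>The Gram map\<close>

text \<open>The quadratic form of \<open>A\<close> in the monomial vector of block \<open>i\<close>.
  The block is a parameter separate from \<open>A\<close>, so that one matrix can be placed in any
  block; group actions and \<open>in_block\<close> only change this parameter.\<close>

definition block_form :: "nat \<Rightarrow> nat \<Rightarrow> nat \<Rightarrow> ((nat \<Rightarrow>\<^sub>0 nat) \<Rightarrow> (nat \<Rightarrow>\<^sub>0 nat) \<Rightarrow> real) \<Rightarrow> (nat \<times> nat)
  rpoly" where
  "block_form m d i A = (\<Sum>s\<in>monomials m d. \<Sum>t\<in>monomials m d. poly_const (A s t) *
     (\<Prod>k\<le>m. poly_var (i, k) ^ Poly_Mapping.lookup s k) *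
     (\<Prod>k\<le>m. poly_var (i, k) ^ Poly_Mapping.lookup t k))"

lemma poly_eval_block_form:
  "poly_eval x (block_form m d i A) = (\<Sum>s\<in>monomials m d. \<Sum>t\<in>monomials m d. A s t *
     (\<Prod>k\<le>m. x (i, k) ^ Poly_Mapping.lookup s k) * (\<Prod>k\<le>m. x (i, k) ^ Poly_Mapping.lookup t k))"
  by (simp add: block_form_def poly_eval_hom)

lemma poly_eval_monomial_entry:
  "poly_eval x (monomial_entry n m a) = (\<Prod>i\<le>n. \<Prod>k\<le>m. x (i, k) ^ Poly_Mapping.lookup (a i) k)"
  by (simp add: monomial_entry_def poly_eval_hom)

lemma poly_eval_gram_map:
  "poly_eval x (gram_map n m d M) = (\<Sum>a\<in>tuples n (monomials m d). \<Sum>b\<in>tuples n (monomials m d).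
     M a b * (poly_eval x (monomial_entry n m a) * poly_eval x (monomial_entry n m b)))"
  by (simp add: gram_map_def poly_eval_hom mult_ac)

text \<open>The product over the blocks is expanded twice, once for the rows and once for the
  columns: choosing a monomial in every block is choosing a tuple.\<close>

lemma gram_map_tensor_matrix:
  "gram_map n m d (tensor_matrix n A) = (\<Prod>i\<le>n. block_form m d i (A i))"
proof (rule poly_eval_inject)
  fix x :: "nat \<times> nat \<Rightarrow> real"
  show "poly_eval x (gram_map n m d (tensor_matrix n A))
    = poly_eval x (\<Prod>i\<le>n. block_form m d i (A i))"
  proof -
    let ?w = "\<lambda>i s. \<Prod>k\<le>m. x (i, k) ^ Poly_Mapping.lookup s k"
    let ?X = "monomials m d"
    have "poly_eval x (\<Prod>i\<le>n. block_form m d i (A i))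
       = (\<Prod>i\<le>n. \<Sum>s\<in>?X. \<Sum>t\<in>?X. A i s t * ?w i s * ?w i t)"
      by (simp only: poly_eval_prod poly_eval_block_form)
    also have "\<dots> = (\<Sum>a\<in>tuples n ?X. \<Prod>i\<le>n. \<Sum>t\<in>?X. A i (a i) t * ?w i (a i) * ?w i t)"
      unfolding tuples_def by (rule prod_sum_PiE) auto
    also have "\<dots> = (\<Sum>a\<in>tuples n ?X. \<Sum>b\<in>tuples n ?X. \<Prod>i\<le>n. A i (a i) (b i) * ?w i (a i) * ?w i (b
      i))"
      unfolding tuples_def by (intro sum.cong refl prod_sum_PiE) auto
    also have "\<dots> = poly_eval x (gram_map n m d (tensor_matrix n A))"
      by (simp only: poly_eval_gram_map poly_eval_monomial_entry tensor_matrix_def prod.distrib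
        mult.assoc)
    finally show ?thesis by simp
  qed
qed

lemma gram_map_sum: "gram_map n m d (\<lambda>a b. \<Sum>j\<in>J. M j a b) = (\<Sum>j\<in>J. gram_map n m d (M j))"
proof (rule poly_eval_inject)
  fix x :: "nat \<times> nat \<Rightarrow> real"
  show "poly_eval x (gram_map n m d (\<lambda>a b. \<Sum>j\<in>J. M j a b))
    = poly_eval x (\<Sum>j\<in>J. gram_map n m d (M j))"
    unfolding poly_eval_sum poly_eval_gram_map sum_distrib_right
    by (subst sum.swap[of _ J], intro sum.cong refl sum.swap)
qed

lemma gram_map_scale: "gram_map n m d (\<lambda>a b. c * M a b) = poly_const c * gram_map n m d M"
  by (rule poly_eval_inject) (simp add: poly_eval_gram_map poly_eval_mult sum_distrib_left mult_ac)

section \<open>Polynomials in a given set of variables\<close>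

lemma polys_in_0: "0 \<in> polys_in V" by (simp add: polys_in_def)

lemma polys_in_const: "poly_const c \<in> polys_in V" by (auto simp: polys_in_def poly_const_def)

lemma polys_in_var: "v \<in> V \<Longrightarrow> poly_var v \<in> polys_in V" by (auto simp: polys_in_def poly_var_def)

lemma polys_in_add: "p \<in> polys_in V \<Longrightarrow> q \<in> polys_in V \<Longrightarrow> p + q \<in> polys_in V"
  using Poly_Mapping.keys_add[of p q] by (auto simp: polys_in_def)

lemma polys_in_mult:
  assumes p: "p \<in> polys_in V" and q: "q \<in> polys_in V"
  shows "p * q \<in> polys_in V"
proof -
  have "Poly_Mapping.keys t \<subseteq> V" if t: "t \<in> Poly_Mapping.keys (p * q)" for t
  proof -
    obtain u v where "t = u + v" "u \<in> Poly_Mapping.keys p" "v \<in> Poly_Mapping.keys q"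
      using t Poly_Mapping.keys_mult[of p q] by blast
    then show ?thesis
      using p q Poly_Mapping.keys_add[of u v] unfolding polys_in_def by blast
  qed
  then show ?thesis by (simp add: polys_in_def)
qed

lemma polys_in_sum: "(\<And>j. j \<in> J \<Longrightarrow> p j \<in> polys_in V) \<Longrightarrow> (\<Sum>j\<in>J. p j) \<in> polys_in V"
  by (induction J rule: infinite_finite_induct) (auto simp: polys_in_0 polys_in_add)

lemma polys_in_1: "1 \<in> polys_in V" by (simp add: polys_in_def)

lemma polys_in_power: "p \<in> polys_in V \<Longrightarrow> p ^ k \<in> polys_in V"
  by (induction k) (auto simp: polys_in_1 polys_in_mult)

lemma polys_in_prod: "(\<And>j. j \<in> J \<Longrightarrow> p j \<in> polys_in V) \<Longrightarrow> (\<Prod>j\<in>J. p j) \<in> polys_in V"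
  by (induction J rule: infinite_finite_induct) (auto simp: polys_in_1 polys_in_mult)

section \<open>Sums of squares\<close>

lemma sos_0: "sos V 0"
  unfolding sos_def by (intro exI[of _ 0]) auto

lemma sos_add:
  assumes "sos V p" "sos V q"
  shows "sos V (p + q)"
proof -
  obtain r h where h: "\<forall>j<r. h j \<in> polys_in V" "p = (\<Sum>j<(r::nat). h j ^ 2)"
    using assms(1) by (auto simp: sos_def)
  obtain s k where k: "\<forall>j<s. k j \<in> polys_in V" "q = (\<Sum>j<(s::nat). k j ^ 2)"
    using assms(2) by (auto simp: sos_def)
  let ?f = "\<lambda>j. if j < r then h j else k (j - r)"
  have "(\<Sum>j<r + t. ?f j ^ 2) = (\<Sum>j<r. h j ^ 2) + (\<Sum>j<t. k j ^ 2)" for t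
    by (induction t) (auto simp: add_ac intro!: sum.cong)
  then have "p + q = (\<Sum>j<r + s. ?f j ^ 2)"
    by (simp only: h k)
  moreover have "\<forall>j<r+s. ?f j \<in> polys_in V" using h k by auto
  ultimately show ?thesis
    unfolding sos_def by (intro exI[of _ "r + s"] exI[of _ ?f]) simp
qed

lemma sos_sum: "(\<And>j. j \<in> J \<Longrightarrow> sos V (p j)) \<Longrightarrow> sos V (\<Sum>j\<in>J. p j)"
  by (induction J rule: infinite_finite_induct) (auto simp: sos_0 sos_add)

text \<open>Each vector of a Gram representation of \<open>A\<close> is the coefficient vector of a
  form of degree \<open>d\<close>; the quadratic form is the sum of the squares of these
  forms.\<close>

lemma sos_block_form:
  assumes "psd_matrix (monomials m d) A"
  shows "sos (block m i) (block_form m d i A)"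
proof -
  obtain r :: nat and v where v: "\<And>s t. s \<in> monomials m d \<Longrightarrow> t \<in> monomials m d \<Longrightarrow>
      A s t = (\<Sum>l<r. v l s * v l t)"
    using psd_matrix_gram[OF finite_monomials assms] by blast
  define h where "h l = (\<Sum>s\<in>monomials m d. poly_const (v l s) *
     (\<Prod>k\<le>m. poly_var (i, k) ^ Poly_Mapping.lookup s k))" for l
  have "h l \<in> polys_in (block m i)" for l
    unfolding h_def
    by (intro polys_in_sum polys_in_mult polys_in_const polys_in_prod polys_in_power polys_in_var)
      (auto simp: block_def)
  moreover have "block_form m d i A = (\<Sum>l<r. h l ^ 2)"
  proof (rule poly_eval_inject)
    fix x :: "nat \<times> nat \<Rightarrow> real"
    let ?w = "\<lambda>s. \<Prod>k\<le>m. x (i, k) ^ Poly_Mapping.lookup s k"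
    have "poly_eval x (block_form m d i A) = 
      (\<Sum>s\<in>monomials m d. \<Sum>t\<in>monomials m d. \<Sum>l<r. (v l s * ?w s) * (v l t * ?w t))"
      by (simp add: poly_eval_block_form v sum_distrib_right sum_distrib_left mult_ac)
    also have "\<dots> = (\<Sum>l<r. \<Sum>s\<in>monomials m d. \<Sum>t\<in>monomials m d. (v l s * ?w s) * (v l t * ?w t))"
      by (subst sum.swap[of _ "{..<r}"], intro sum.cong refl sum.swap)
    also have "\<dots> = poly_eval x (\<Sum>l<r. h l ^ 2)"
      by (simp add: poly_eval_hom h_def power2_eq_square sum_product)
    finally show "poly_eval x (block_form m d i A) = poly_eval x (\<Sum>l<r. h l ^ 2)" .
  qed
  ultimately show ?thesis
    unfolding sos_def by (intro exI[of _ r] exI[of _ h]) simp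
qed

lemma poly_eval_in_block: "poly_eval x (in_block j p) = poly_eval (\<lambda>(i, k). x (j, k)) p"
  unfolding in_block_def poly_eval_subst by (rule arg_cong[where f = "\<lambda>a. poly_eval a p"]) auto

lemma in_block_block_form: "in_block j (block_form m d i A) = block_form m d j A"
  by (rule poly_eval_inject) (simp add: poly_eval_in_block poly_eval_block_form)

lemma in_block_sum: "in_block j (\<Sum>x\<in>J. p x) = (\<Sum>x\<in>J. in_block j (p x))"
  by (rule poly_eval_inject) (simp add: poly_eval_in_block poly_eval_sum)

lemma poly_eval_act_poly: "poly_eval x (act_poly \<phi> g p) = poly_eval (\<lambda>(i, k). x (\<phi> g i, k)) p"
  unfolding act_poly_def poly_eval_subst by (rule arg_cong[where f = "\<lambda>a. poly_eval a p"]) auto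

text \<open>The degree may vary with the block, since single variables do not have the same degree
  in all blocks. Multiplication then adds the degree functions, and the constant function recovers
  \<open>homogeneous_polys\<close>.\<close>

definition multihomogeneous :: "nat \<Rightarrow> nat \<Rightarrow> (nat \<Rightarrow> nat) \<Rightarrow> (nat \<times> nat) rpoly set" where
  "multihomogeneous n m e = {p \<in> polys_in ({..n} \<times> {..m}).
     \<forall>t\<in>Poly_Mapping.keys p. \<forall>i\<le>n. (\<Sum>k\<le>m. Poly_Mapping.lookup t (i, k)) = e i}"

lemma multihomogeneous_0: "0 \<in> multihomogeneous n m e"
  by (simp add: multihomogeneous_def polys_in_def)

lemma multihomogeneous_const: "poly_const c \<in> multihomogeneous n m (\<lambda>_. 0)"
  by (auto simp: multihomogeneous_def polys_in_const) (auto simp: poly_const_def split: if_splits)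

lemma multihomogeneous_var:
  "i \<le> n \<Longrightarrow> k \<le> m \<Longrightarrow> poly_var (i, k) \<in> multihomogeneous n m (\<lambda>j. if j = i then 1 else 0)"
  by (auto simp: multihomogeneous_def polys_in_var) (auto simp: poly_var_def lookup_single when_def)

lemma multihomogeneous_add:
  "p \<in> multihomogeneous n m e \<Longrightarrow> q \<in> multihomogeneous n m e \<Longrightarrow> p + q \<in> multihomogeneous n m e"
  using Poly_Mapping.keys_add[of p q] unfolding multihomogeneous_def
  by (auto simp: polys_in_add)

lemma multihomogeneous_mult:
  assumes "p \<in> multihomogeneous n m e" "q \<in> multihomogeneous n m e'"
  shows "p * q \<in> multihomogeneous n m (\<lambda>i. e i + e' i)"
proof -
  have "(\<Sum>k\<le>m. Poly_Mapping.lookup t (i, k)) = e i + e' i"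
    if t: "t \<in> Poly_Mapping.keys (p * q)" and i: "i \<le> n" for t i
  proof -
    obtain u v where "t = u + v" "u \<in> Poly_Mapping.keys p" "v \<in> Poly_Mapping.keys q"
      using t Poly_Mapping.keys_mult[of p q] by blast
    then show ?thesis
      using assms i by (simp add: multihomogeneous_def lookup_add sum.distrib)
  qed
  then show ?thesis using assms by (simp add: multihomogeneous_def polys_in_mult)
qed

lemma multihomogeneous_sum:
  "(\<And>j. j \<in> J \<Longrightarrow> p j \<in> multihomogeneous n m e) \<Longrightarrow> (\<Sum>j\<in>J. p j) \<in> multihomogeneous n m e"
  by (induction J rule: infinite_finite_induct) (auto simp: multihomogeneous_0 multihomogeneous_add)

lemma multihomogeneous_1: "1 \<in> multihomogeneous n m (\<lambda>_. 0)"
  using multihomogeneous_const[of 1] by (simp add: poly_const_def)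

lemma multihomogeneous_power:
  "p \<in> multihomogeneous n m e \<Longrightarrow> p ^ k \<in> multihomogeneous n m (\<lambda>i. k * e i)"
  by (induction k) (auto simp: multihomogeneous_1 dest: multihomogeneous_mult)

lemma multihomogeneous_prod:
  "(\<And>j. j \<in> J \<Longrightarrow> p j \<in> multihomogeneous n m (e j)) \<Longrightarrow>
    (\<Prod>j\<in>J. p j) \<in> multihomogeneous n m (\<lambda>i. \<Sum>j\<in>J. e j i)"
  by (induction J rule: infinite_finite_induct)
    (auto simp: multihomogeneous_1 dest: multihomogeneous_mult)

lemma monomial_entry_multihomogeneous:
  assumes "a \<in> tuples n (monomials m d)"
  shows "monomial_entry n m a \<in> multihomogeneous n m (\<lambda>i. \<Sum>j\<le>n. \<Sum>k\<le>m. Poly_Mapping.lookup (a j) k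
    * (if i = j then 1 else 0))"
  unfolding monomial_entry_def
  by (intro multihomogeneous_prod multihomogeneous_power multihomogeneous_var) auto

lemma gram_map_homogeneous: "gram_map n m d M \<in> homogeneous_polys n m (2 * d)"
proof -
  let ?e = "\<lambda>a i. \<Sum>j\<le>n. \<Sum>k\<le>m. Poly_Mapping.lookup (a j) k * (if i = j then 1 else 0)"
  have e: "?e a i = d" if "a \<in> tuples n (monomials m d)" "i \<le> n" for a i
  proof -
    have "?e a i = (\<Sum>j\<le>n. if i = j then (\<Sum>k\<le>m. Poly_Mapping.lookup (a j) k) else 0)"
      by (intro sum.cong) auto
    also have "\<dots> = d" using that by (auto simp: tuples_def monomials_def PiE_iff)
    finally show ?thesis .
  qed
  have "gram_map n m d M \<in> multihomogeneous n m (\<lambda>_. 2 * d)"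
    unfolding gram_map_def
  proof (intro multihomogeneous_sum)
    fix a b assume ab: "a \<in> tuples n (monomials m d)" "b \<in> tuples n (monomials m d)"
    have "monomial_entry n m a * poly_const (M a b) * monomial_entry n m b
      \<in> multihomogeneous n m (\<lambda>i. (?e a i + 0) + ?e b i)"
      using ab by (intro multihomogeneous_mult multihomogeneous_const
        monomial_entry_multihomogeneous[where d = d])
    \<comment> \<open>The two degree functions are known to agree only for \<open>i \<le> n\<close>,
      which is all that the definition inspects.\<close>
    then show "monomial_entry n m a * poly_const (M a b) * monomial_entry n m b
      \<in> multihomogeneous n m (\<lambda>i. 2 * d)"
      using e ab by (simp add: multihomogeneous_def)
  qed
  then show ?thesis by (simp add: multihomogeneous_def homogeneous_polys_def)
qed

section \<open>Norm bound and approximation\<close>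

text \<open>Multinomial coefficients are at least 1. With \<open>y\<close> the squares of the
  coordinates of a unit vector, this bounds the norm of its monomial vector by 1.\<close>

lemma sum_monomials_le_power:
  fixes y :: "nat \<Rightarrow> real"
  assumes y: "\<And>k. 0 \<le> y k"
  shows "(\<Sum>s\<in>monomials m d. \<Prod>k\<le>m. y k ^ Poly_Mapping.lookup s k) \<le> (\<Sum>k\<le>m. y k) ^ d"
proof (induction d)
  case 0
  have "monomials m 0 = {0}"
    by (auto simp: monomials_def intro!: poly_mapping_eqI) (metis atMost_iff in_keys_iff subset_iff)
  then show ?case by simp
next
  case (Suc d)
  let ?w = "\<lambda>s. \<Prod>k\<le>m. y k ^ Poly_Mapping.lookup s k"
  let ?f = "\<lambda>(k, s). Poly_Mapping.single k 1 + s :: nat \<Rightarrow>\<^sub>0 nat"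
  have sub: "monomials m (Suc d) \<subseteq> ?f ` ({..m} \<times> monomials m d)"
  proof
    fix s assume s: "s \<in> monomials m (Suc d)"
    then have "(\<Sum>k\<le>m. Poly_Mapping.lookup s k) \<noteq> 0" by (simp add: monomials_def)
    then obtain j where j: "j \<le> m" "Poly_Mapping.lookup s j \<noteq> 0" by (meson atMost_iff sum.neutral)
    let ?u = "s - Poly_Mapping.single j 1"
    have s_eq: "s = Poly_Mapping.single j 1 + ?u"
      using j by (intro poly_mapping_eqI) (auto simp: lookup_add lookup_minus lookup_single
        when_def)
    have "(\<Sum>k\<le>m. Poly_Mapping.lookup s k) = 1 + (\<Sum>k\<le>m. Poly_Mapping.lookup ?u k)"
      using j by (subst s_eq) (simp add: lookup_add sum.distrib lookup_single when_def)
    then have "?u \<in> monomials m d"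
      using s by (auto simp: monomials_def in_keys_iff lookup_minus subset_iff)
    then show "s \<in> ?f ` ({..m} \<times> monomials m d)"
      using s_eq j by (intro image_eqI[of _ _ "(j, ?u)"]) auto
  qed
  have w: "?w (Poly_Mapping.single j 1 + s) = y j * ?w s" if "j \<le> m" for j s
  proof -
    have "(\<Prod>k\<le>m. y k ^ (if j = k then Suc 0 else 0)) = (\<Prod>k\<le>m. if j = k then y k else 1)"
      by (intro prod.cong) auto
    also have "\<dots> = y j" using that by simp
    finally show ?thesis
      by (simp add: lookup_add power_add prod.distrib lookup_single when_def)
  qed
  have "(\<Sum>s\<in>monomials m (Suc d). ?w s) \<le> (\<Sum>s\<in>?f ` ({..m} \<times> monomials m d). ?w s)"
    using y by (intro sum_mono2 sub) (auto intro!: prod_nonneg)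
  \<comment> \<open>A monomial of degree \<open>d + 1\<close> may arise from several pairs of a
    variable and a monomial; counting it repeatedly only increases a sum of nonnegative
    terms.\<close>
  also have "\<dots> \<le> (\<Sum>js\<in>{..m} \<times> monomials m d. ?w (?f js))"
    using y by (intro sum_image_le[where g = ?w, unfolded o_def]) (auto intro!: prod_nonneg)
  also have "\<dots> = (\<Sum>js\<in>{..m} \<times> monomials m d. y (fst js) * ?w (snd js))"
    using w by (intro sum.cong) auto
  also have "\<dots> = (\<Sum>j\<le>m. y j) * (\<Sum>s\<in>monomials m d. ?w s)"
    by (simp add: sum_product sum.cartesian_product split_def)
  also have "\<dots> \<le> (\<Sum>j\<le>m. y j) * (\<Sum>k\<le>m. y k) ^ d"
    using y by (intro mult_left_mono Suc.IH sum_nonneg) auto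
  finally show ?case by simp
qed

text \<open>On the spheres the tensor product \<open>?W\<close> of the monomial vectors has norm at
  most 1, since squared norms multiply. The value of the Gram map is the inner product of
  \<open>M\<close> with \<open>?W a * ?W b\<close>, so Cauchy-Schwarz applies.\<close>

lemma gram_map_sphere_bound:
  fixes x :: "nat \<Rightarrow> nat \<Rightarrow> real"
  assumes x: "\<And>i. i \<le> n \<Longrightarrow> L2_set (x i) {..m} = 1"
  shows "(poly_eval (\<lambda>(i, k). x i k) (gram_map n m d M))\<^sup>2
     \<le> (\<Sum>a\<in>tuples n (monomials m d). \<Sum>b\<in>tuples n (monomials m d). (M a b)\<^sup>2)"
proof -
  let ?T = "tuples n (monomials m d)"
  let ?W = "\<lambda>a. poly_eval (\<lambda>(i, k). x i k) (monomial_entry n m a)"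
  have "(\<Sum>a\<in>?T. (?W a)\<^sup>2) = (\<Prod>i\<le>n. \<Sum>s\<in>monomials m d. \<Prod>k\<le>m. ((x i k)\<^sup>2) ^ Poly_Mapping.lookup s k)"
    by (simp add: poly_eval_monomial_entry prod_sum_PiE tuples_def prod_power_distrib
      power_mult[symmetric] mult.commute)
  also have "\<dots> \<le> (\<Prod>i\<le>n. (\<Sum>k\<le>m. (x i k)\<^sup>2) ^ d)"
    by (intro prod_mono conjI sum_monomials_le_power) (auto intro!: sum_nonneg prod_nonneg)
  also have "\<dots> = 1" using x by (simp add: L2_set_def)
  finally have W: "(\<Sum>a\<in>?T. (?W a)\<^sup>2) \<le> 1" .
  have "(poly_eval (\<lambda>(i, k). x i k) (gram_map n m d M))\<^sup>2
      = (\<Sum>(a, b)\<in>?T \<times> ?T. M a b * (?W a * ?W b))\<^sup>2"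
    by (simp add: poly_eval_gram_map sum.cartesian_product)
  also have "\<dots> \<le> (\<Sum>(a, b)\<in>?T \<times> ?T. (M a b)\<^sup>2) * (\<Sum>(a, b)\<in>?T \<times> ?T. (?W a * ?W b)\<^sup>2)"
    using Cauchy_Schwarz_ineq_sum[of "\<lambda>(a, b). M a b" "\<lambda>(a, b). ?W a * ?W b" "?T \<times> ?T"]
    by (simp add: split_def)
  also have "(\<Sum>(a, b)\<in>?T \<times> ?T. (?W a * ?W b)\<^sup>2) = (\<Sum>a\<in>?T. (?W a)\<^sup>2) * (\<Sum>a\<in>?T. (?W a)\<^sup>2)"
    by (simp add: sum_product sum.cartesian_product power_mult_distrib)
  also have "(\<Sum>(a, b)\<in>?T \<times> ?T. (M a b)\<^sup>2) * ((\<Sum>a\<in>?T. (?W a)\<^sup>2) * (\<Sum>a\<in>?T. (?W a)\<^sup>2))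
     \<le> (\<Sum>(a, b)\<in>?T \<times> ?T. (M a b)\<^sup>2) * (1 * 1)"
    using W by (intro mult_left_mono mult_mono) (auto intro!: sum_nonneg)
  finally show ?thesis by (simp add: sum.cartesian_product)
qed

section \<open>Scaling tensor products and sampling from separable matrices\<close>

lemma psd_matrix_scale:
  assumes "0 \<le> c" "psd_matrix X A"
  shows "psd_matrix X (\<lambda>s t. c * A s t)"
proof -
  have "(\<Sum>s\<in>X. \<Sum>t\<in>X. v s * (c * A s t) * v t) = c * (\<Sum>s\<in>X. \<Sum>t\<in>X. v s * A s t * v t)" for v
    by (simp add: sum_distrib_left mult_ac)
  then show ?thesis using assms by (auto simp: psd_matrix_def intro!: mult_nonneg_nonneg)
qed

text \<open>The scalar is spread evenly over the \<open>n + 1\<close> factors by a nonnegative root,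
  which keeps them positive semidefinite and makes scaling commute with permutations of the
  factors.\<close>

lemma tensor_matrix_scale:
  assumes "0 \<le> c"
  shows "tensor_matrix n (\<lambda>i s t. root (Suc n) c * A i s t) a b = c * tensor_matrix n A a b"
proof -
  have "root (Suc n) c ^ Suc n = c" using assms by (intro real_root_pow_pos2) auto
  then show ?thesis by (simp add: tensor_matrix_def prod.distrib)
qed

lemma matrix_trace_sum: "matrix_trace n X (\<lambda>a b. \<Sum>j\<in>J. M j a b) = (\<Sum>j\<in>J. matrix_trace n X (M j))"
  unfolding matrix_trace_def by (rule sum.swap)

lemma SEP_approximation:
  assumes X: "finite X" and M: "M \<in> SEP n X" and l: "0 \<le> c" and k: "0 < k"
  shows "\<exists>B. (\<forall>l<k. \<forall>i\<le>n. psd_matrix X (B l i)) \<and>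
    (\<Sum>a\<in>tuples n X. \<Sum>b\<in>tuples n X. (c * M a b - (\<Sum>l<(k::nat). tensor_matrix n (B l) a b))\<^sup>2)
      \<le> c\<^sup>2 / real k"
proof -
  let ?T = "tuples n X"
  obtain r :: nat and A where A: "\<And>j i. j < r \<Longrightarrow> i \<le> n \<Longrightarrow> psd_matrix X (A j i)"
    and MA: "\<And>a b. a \<in> ?T \<Longrightarrow> b \<in> ?T \<Longrightarrow> M a b = (\<Sum>j<r. tensor_matrix n (A j) a b)"
    using M unfolding SEP_def separable_matrix_def by blast
  define \<tau> where "\<tau> j = matrix_trace n X (tensor_matrix n (A j))" for j
  have \<tau>0: "0 \<le> \<tau> j" if "j < r" for j
    unfolding \<tau>_def using that by (intro tensor_matrix_trace_nonneg X A)
  have frob: "(\<Sum>a\<in>?T. \<Sum>b\<in>?T. (tensor_matrix n (A j) a b)\<^sup>2) \<le> (\<tau> j)\<^sup>2" if "j < r" for j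
    unfolding \<tau>_def using that by (intro tensor_matrix_frobenius X A)
  have "(\<Sum>j<r. \<tau> j) = matrix_trace n X M"
    unfolding \<tau>_def matrix_trace_sum[symmetric] by (simp add: matrix_trace_def MA)
  then have \<tau>1: "(\<Sum>j<r. \<tau> j) \<le> 1" using M by (simp add: SEP_def)
  \<comment> \<open>For \<open>j < r\<close> the product is normalised to trace 1, or becomes zero
    if \<open>\<tau> j = 0\<close>, because then \<open>1 / \<tau> j = 0\<close>. The additional
    index \<open>r\<close> stands for the zero matrix.\<close>
  define C where "C j i s t = (if j < r then root (Suc n) (1 / \<tau> j) * A j i s t else 0)" for j i s t
  have C: "psd_matrix X (C j i)" if "i \<le> n" for j i
  proof (cases "j < r")
    case True
    then have "C j i = (\<lambda>s t. root (Suc n) (1 / \<tau> j) * A j i s t)" by (simp add: C_def fun_eq_iff)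
    then show ?thesis using psd_matrix_scale[OF _ A[OF True that]] \<tau>0[OF True] by simp
  qed (simp add: C_def psd_matrix_def)
  have TC: "tensor_matrix n (C j) a b
    = (if j < r then tensor_matrix n (A j) a b / \<tau> j else 0)" for j a b
  proof (cases "j < r")
    case True
    then have "C j = (\<lambda>i s t. root (Suc n) (1 / \<tau> j) * A j i s t)" by (simp add: C_def fun_eq_iff)
    then show ?thesis using tensor_matrix_scale[of "1 / \<tau> j"] \<tau>0[OF True] True by simp
  qed (simp add: C_def tensor_matrix_def)
  \<comment> \<open>The zero matrix at index \<open>r\<close> takes up the weight by which the trace
    of \<open>M\<close> falls short of 1, so the weights sum to exactly 1.\<close>
  define w where "w j = (if j < r then \<tau> j else 1 - (\<Sum>j<r. \<tau> j))" for j
  have zero: "tensor_matrix n (A j) a b = 0" if "j < r" "\<tau> j = 0" "a \<in> ?T" "b \<in> ?T" for j a b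
  proof -
    have "\<bar>tensor_matrix n (A j) a b\<bar> \<le> \<tau> j"
      unfolding \<tau>_def using that by (intro tensor_matrix_entry_le_trace X A)
    then show ?thesis using that(2) by simp
  qed
  have "\<exists>f. (\<forall>l<k. f l \<in> {..r}) \<and> (\<Sum>e\<in>?T \<times> ?T. (\<Sum>l<k. 
     (\<lambda>j (a, b). tensor_matrix n (C j) a b) (f l) e - (\<lambda>(a, b). M a b) e)\<^sup>2) \<le> real k"
  proof (rule maurey_greedy[where w = w])
    show "0 \<le> w j" for j using \<tau>0 \<tau>1 by (simp add: w_def)
    show "(\<Sum>j\<le>r. w j) = 1" by (simp add: w_def atMost_Suc lessThan_Suc_atMost[symmetric])
    fix j
    show "(\<Sum>e\<in>?T \<times> ?T. (case e of (a, b) \<Rightarrow> tensor_matrix n (C j) a b)\<^sup>2) \<le> 1"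
    proof (cases "j < r \<and> \<tau> j \<noteq> 0")
      case True
      then have "(\<Sum>e\<in>?T \<times> ?T. (case e of (a, b) \<Rightarrow> tensor_matrix n (C j) a b)\<^sup>2)
         = (\<Sum>a\<in>?T. \<Sum>b\<in>?T. (tensor_matrix n (A j) a b)\<^sup>2) / (\<tau> j)\<^sup>2"
        by (simp add: TC sum.cartesian_product split_def power_divide sum_divide_distrib)
      also have "\<dots> \<le> 1" using frob[of j] True by (simp add: divide_le_eq)
      finally show ?thesis .
    next
      case False
      then have "(\<Sum>e\<in>?T \<times> ?T. (case e of (a, b) \<Rightarrow> tensor_matrix n (C j) a b)\<^sup>2) = 0"
        by (intro sum.neutral) (auto simp: TC)
      then show ?thesis by simp
    qed
  next
    fix e assume "e \<in> ?T \<times> ?T"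
    then obtain a b where e: "e = (a, b)" "a \<in> ?T" "b \<in> ?T" by auto
    have "(\<Sum>j\<le>r. w j * tensor_matrix n (C j) a b) = (\<Sum>j<r. w j * tensor_matrix n (C j) a b)"
      by (simp add: lessThan_Suc_atMost[symmetric] TC)
    also have "\<dots> = (\<Sum>j<r. tensor_matrix n (A j) a b)"
      using zero e by (intro sum.cong) (auto simp: TC w_def)
    finally show "(case e of (a, b) \<Rightarrow> M a b)
      = (\<Sum>j\<le>r. w j * (case e of (a, b) \<Rightarrow> tensor_matrix n (C j) a b))"
      using e MA by simp
  qed (use X in auto)
  then obtain f where f: "(\<Sum>a\<in>?T. \<Sum>b\<in>?T. (\<Sum>l<k. tensor_matrix n (C (f l)) a b - M a b)\<^sup>2) \<le> real k"
    by (auto simp: sum.cartesian_product split_def)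
  \<comment> \<open>The products are rescaled so that their sum is \<open>c\<close> times the
    average of the \<open>k\<close> selected ones; the error bound becomes
    \<open>(c / k)^2 * k\<close>.\<close>
  define B where "B l i s t = root (Suc n) (c / real k) * C (f l) i s t" for l i s t
  have ck: "0 \<le> c / real k" using l by simp
  have "psd_matrix X (B l i)" if "i \<le> n" for l i
    unfolding B_def using ck by (intro psd_matrix_scale C that) auto
  moreover have "(\<Sum>a\<in>?T. \<Sum>b\<in>?T. (c * M a b - (\<Sum>l<k. tensor_matrix n (B l) a b))\<^sup>2) \<le> c\<^sup>2 / real k"
  proof -
    have "(c * M a b - (\<Sum>l<k. tensor_matrix n (B l) a b))\<^sup>2
      = (c / real k)\<^sup>2 * (\<Sum>l<k. tensor_matrix n (C (f l)) a b - M a b)\<^sup>2" for a b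
    proof -
      have "c * M a b - (\<Sum>l<k. tensor_matrix n (B l) a b) =
        - ((c / real k) * (\<Sum>l<k. tensor_matrix n (C (f l)) a b - M a b))"
        using k unfolding B_def tensor_matrix_scale[OF ck] sum_distrib_left[symmetric]
        by (simp add: sum_subtractf right_diff_distrib)
      then show ?thesis by (simp only: power2_minus power_mult_distrib)
    qed
    then have "(\<Sum>a\<in>?T. \<Sum>b\<in>?T. (c * M a b - (\<Sum>l<k. tensor_matrix n (B l) a b))\<^sup>2)
      = (c / real k)\<^sup>2 * (\<Sum>a\<in>?T. \<Sum>b\<in>?T. (\<Sum>l<k. tensor_matrix n (C (f l)) a b - M a b)\<^sup>2)"
      by (simp add: sum_distrib_left)
    also have "\<dots> \<le> (c / real k)\<^sup>2 * real k"
      by (intro mult_left_mono f) simp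
    also have "\<dots> = c\<^sup>2 / real k" using k by (simp add: power2_eq_square)
    finally show ?thesis .
  qed
  ultimately show ?thesis by blast
qed

section \<open>Decompositions from averages over the group\<close>

lemma facet_containing:
  assumes "weighted_complex n \<Omega>" "i \<le> n"
  shows "\<exists>F\<in>facets n \<Omega>. i \<in> F"
proof -
  let ?S = "{S \<in> simplices n \<Omega>. {i} \<subseteq> S}"
  have "finite (simplices n \<Omega>)"
    by (rule finite_subset[of _ "Pow {..n}"]) (auto simp: simplices_def)
  moreover have "{i} \<in> simplices n \<Omega>"
    using assms by (auto simp: simplices_def weighted_complex_def)
  ultimately obtain F where "F \<in> ?S" "\<forall>S\<in>?S. F \<subseteq> S \<longrightarrow> F = S"
    using finite_has_maximal[of ?S] by auto
  then show ?thesis unfolding facets_def by blast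
qed

lemma facet_copy_zero: "F \<in> facets n \<Omega> \<Longrightarrow> (F, 0) \<in> facet_copies n \<Omega>"
  by (auto simp: facet_copies_def facets_def simplices_def)

lemma facet_copies_at_nonempty:
  assumes "weighted_complex n \<Omega>" "i \<le> n"
  shows "facet_copies_at n \<Omega> i \<noteq> {}"
  using facet_containing[OF assms] facet_copy_zero by (fastforce simp: facet_copies_at_def)

text \<open>The empty set is not a facet, because vertex 0 lies in some facet and this facet would
  be larger. Hence the restrictions of \<open>\<alpha>\<close> to the vertices determine all of
  \<open>\<alpha>\<close>.\<close>

lemma facet_copies_cover:
  assumes "weighted_complex n \<Omega>" "f \<in> facet_copies n \<Omega>"
  shows "\<exists>i\<le>n. f \<in> facet_copies_at n \<Omega> i"
proof -
  have F: "fst f \<in> facets n \<Omega>" using assms(2) by (auto simp: facet_copies_def)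
  have "fst f \<noteq> {}"
  proof
    assume "fst f = {}"
    then show False using F facet_containing[OF assms(1), of 0]
      unfolding facets_def by blast
  qed
  moreover have "fst f \<subseteq> {..n}" using F by (auto simp: facets_def simplices_def)
  ultimately show ?thesis using assms(2) by (auto simp: facet_copies_at_def)
qed

lemma finite_facet_copies: "finite (facet_copies n \<Omega>)"
proof -
  have "finite (facets n \<Omega>)"
    by (rule finite_subset[of _ "Pow {..n}"]) (auto simp: simplices_def facets_def)
  then show ?thesis by (simp add: facet_copies_def)
qed

text \<open>In each orbit a representative is chosen, and \<open>z f\<close> is the group element
  that carries it to \<open>f\<close>. Freeness makes this element unique, and uniqueness gives
  equivariance.\<close>

lemma free_action_equivariant_map:
  fixes G (structure)
  assumes "group_action G E \<psi>" and free: "\<And>f. f \<in> E \<Longrightarrow> stabilizer G \<psi> f = {\<one>\<^bsub>G\<^esub>}"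
  shows "\<exists>z. \<forall>f\<in>E. z f \<in> carrier G \<and> (\<forall>g\<in>carrier G. z (\<psi> g f) = g \<otimes>\<^bsub>G\<^esub> z f)"
proof -
  interpret group_action G E \<psi> by fact
  interpret group G using group_hom group_hom.axioms(1) by auto
  \<comment> \<open>The choice depends only on the orbit as a set, so elements of the same orbit
    receive the same representative.\<close>
  define rep where "rep f = (SOME e. e \<in> orbit G \<psi> f)" for f
  have rep: "rep f \<in> E \<and> (\<exists>g\<in>carrier G. \<psi> g (rep f) = f)" if "f \<in> E" for f
  proof -
    have "rep f \<in> orbit G \<psi> f"
      unfolding rep_def using orbit_refl[OF that] by (rule someI)
    moreover from this have "rep f \<in> E"
      using that element_image by (auto simp: orbit_def)
    ultimately have "f \<in> orbit G \<psi> (rep f)" using orbit_sym that by blast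
    then obtain g where "g \<in> carrier G" "f = \<psi> g (rep f)" unfolding orbit_def by blast
    then show ?thesis using \<open>rep f \<in> E\<close> by metis
  qed
  define z where "z f = (SOME g. g \<in> carrier G \<and> \<psi> g (rep f) = f)" for f
  have z: "z f \<in> carrier G \<and> \<psi> (z f) (rep f) = f" if "f \<in> E" for f
    using someI_ex[of "\<lambda>g. g \<in> carrier G \<and> \<psi> g (rep f) = f"] rep[OF that]
    unfolding z_def[symmetric] by blast
  have unique: "g = g'" if "g \<in> carrier G" "g' \<in> carrier G" "e \<in> E" "\<psi> g e = \<psi> g' e" for g g' e
  proof -
    have "\<psi> (inv g' \<otimes> g) e = \<psi> (inv g') (\<psi> g' e)"
      using that composition_rule[of e "inv g'" g] by simp
    also have "\<dots> = e" using that orbit_sym_aux by blast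
    finally have "inv g' \<otimes> g \<in> stabilizer G \<psi> e" using that by (simp add: stabilizer_def)
    then have "inv g' \<otimes> g = \<one>" using free[OF that(3)] by simp
    then show "g = g'" using that by (metis inv_closed inv_inv inv_equality)
  qed
  have "z (\<psi> g f) = g \<otimes> z f" if f: "f \<in> E" and g: "g \<in> carrier G" for f g
  proof -
    have gf: "\<psi> g f \<in> E" using element_image f g by blast
    have "orbit G \<psi> (\<psi> g f) = orbit G \<psi> f"
    proof -
      have fwd: "\<psi> g f \<in> orbit G \<psi> f" using g by (auto simp: orbit_def)
      have bwd: "f \<in> orbit G \<psi> (\<psi> g f)" by (rule orbit_sym[OF f gf fwd])
      have in_E: "e \<in> E" if "x \<in> E" "e \<in> orbit G \<psi> x" for x e
        using that element_image by (auto simp: orbit_def)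
      show ?thesis
      proof (intro equalityI subsetI)
        fix e assume e: "e \<in> orbit G \<psi> (\<psi> g f)"
        show "e \<in> orbit G \<psi> f" by (rule orbit_trans[OF f gf in_E[OF gf e] fwd e])
      next
        fix e assume e: "e \<in> orbit G \<psi> f"
        show "e \<in> orbit G \<psi> (\<psi> g f)" by (rule orbit_trans[OF gf f in_E[OF f e] bwd e])
      qed
    qed
    then have r: "rep (\<psi> g f) = rep f" by (simp add: rep_def)
    have "\<psi> (z (\<psi> g f)) (rep f) = \<psi> g (\<psi> (z f) (rep f))" using z[OF gf] z[OF f] r by simp
    also have "\<dots> = \<psi> (g \<otimes> z f) (rep f)" using composition_rule rep[OF f] g z[OF f] by simp
    finally show ?thesis using unique z[OF f] z[OF gf] rep[OF f] g by (metis m_closed)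
  qed
  then show ?thesis using z by blast
qed

text \<open>Freeness gives an equivariant map \<open>z\<close> from the facet copies to \<open>G\<close>. The index set is
  \<open>{..<k} \<times> G\<close>, encoded by \<open>e\<close>, and the local polynomial at \<open>\<beta>\<close> is nonzero only if \<open>\<beta>\<close> is a
  restriction of \<open>f \<mapsto> (l, h\<^sup>-\<^sup>1 z f)\<close> for some \<open>(l, h)\<close>. This pair is unique, and neighbours share
  a facet copy, so connectedness makes the pairs at all vertices agree.\<close>

lemma sep_rank_le:
  fixes G (structure)
  assumes W: "weighted_complex n \<Omega>" and conn: "connected_complex n \<Omega>"
    and "group G" and fin: "finite (carrier G)"
    and free: "free_complex_action G n \<Omega> \<phi> \<psi>"
    and sos: "\<And>l j i. l < k \<Longrightarrow> j \<le> n \<Longrightarrow> i \<le> n \<Longrightarrow> sos (block m i) (P l j i)"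
    and P: "\<And>l j i i'. in_block i (P l j i') = P l j i"
    and q: "q = (\<Sum>l<k. \<Sum>g\<in>carrier G. \<Prod>i\<le>n. P l (\<phi> (inv g) i) i)"
  shows "sep_rank G n m \<Omega> \<phi> \<psi> q \<le> enat (k * card (carrier G))"
proof -
  interpret group G by fact
  have act: "group_action G {..n} \<phi>" "group_action G (facet_copies n \<Omega>) \<psi>"
    and fst_act: "\<And>g f. g \<in> carrier G \<Longrightarrow> f \<in> facet_copies n \<Omega> \<Longrightarrow> fst (\<psi> g f) = \<phi> g ` fst f"
    and stab: "\<And>f. f \<in> facet_copies n \<Omega> \<Longrightarrow> stabilizer G \<psi> f = {\<one>}"
    using free by (auto simp: free_complex_action_def complex_action_def)
  interpret V: group_action G "{..n}" \<phi> by (rule act)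
  interpret F: group_action G "facet_copies n \<Omega>" \<psi> by (rule act)
  let ?F = "facet_copies n \<Omega>" and ?Fi = "facet_copies_at n \<Omega>"
  obtain z where z: "\<And>f. f \<in> ?F \<Longrightarrow> z f \<in> carrier G"
    and z_act: "\<And>f g. f \<in> ?F \<Longrightarrow> g \<in> carrier G \<Longrightarrow> z (\<psi> g f) = g \<otimes> z f"
    using free_action_equivariant_map[OF act(2) stab] by blast
  let ?L = "{..<k} \<times> carrier G"
  let ?I = "{..<k * card (carrier G)}"
  obtain e where "bij_betw e ?L {0..<card ?L}"
    using ex_bij_betw_finite_nat[of ?L] fin by auto
  then have e: "bij_betw e ?L ?I" by (simp add: card_cartesian_product lessThan_atLeast0)
  \<comment> \<open>The factor \<open>inv h\<close> on the left makes translation by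
    \<open>g\<close> carry the pattern of \<open>(l, h)\<close> to the pattern of
    \<open>(l, g \<otimes> h)\<close>.\<close>
  define pat where "pat = (\<lambda>(l, h) f. e (l, inv h \<otimes> z f))"
  define Mt where "Mt i \<beta> = {lh \<in> ?L. \<forall>f\<in>?Fi i. \<beta> f = pat lh f}" for i \<beta>
  \<comment> \<open>The sum has at most one term at a vertex. Written as a sum it is zero when
    nothing matches, and equivariance becomes a reindexing.\<close>
  define h where "h i \<beta> = (\<Sum>lh\<in>Mt i \<beta>. P (fst lh) (\<phi> (inv (snd lh)) i) i)" for i \<beta>
  have Fi_sub: "f \<in> ?F" if "f \<in> ?Fi i" for f i using that by (simp add: facet_copies_at_def)
  have V_in: "\<phi> g i \<le> n" if "g \<in> carrier G" "i \<le> n" for g i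
    using V.element_image[of g i] that by auto
  have F_in: "\<psi> g f \<in> ?F" if "g \<in> carrier G" "f \<in> ?F" for g f
    using F.element_image that by blast
  have Mt_fin: "finite (Mt i \<beta>)" for i \<beta>
    by (rule finite_subset[of _ ?L]) (use fin in \<open>auto simp: Mt_def\<close>)
  \<comment> \<open>A single facet copy already reveals the pair: \<open>e\<close> is injective, and
    \<open>z f\<close> can be cancelled.\<close>
  have pat_inj: "lh = lh'" if "lh \<in> ?L" "lh' \<in> ?L" "f \<in> ?F" "pat lh f = pat lh' f" for lh lh' f
  proof -
    obtain l g l' g' where [simp]: "lh = (l, g)" "lh' = (l', g')" by (metis surj_pair)
    have "(l, inv g \<otimes> z f) = (l', inv g' \<otimes> z f)"
      using that z[OF that(3)] by (intro inj_onD[OF bij_betw_imp_inj_on[OF e]]) (auto simp: pat_def)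
    then have "l = l'" "inv g = inv g'" using that z[OF that(3)] by auto
    then show ?thesis using that inv_inj by (auto dest: inj_onD)
  qed
  have Mt_unique: "lh = lh'" if "lh \<in> Mt i \<beta>" "lh' \<in> Mt i \<beta>" "i \<le> n" for lh lh' i \<beta>
  proof -
    have "?Fi i \<noteq> {}" by (rule facet_copies_at_nonempty[OF W that(3)])
    then obtain f where f: "f \<in> ?Fi i" by blast
    have "lh \<in> ?L" "lh' \<in> ?L" using that(1,2) by (simp_all add: Mt_def)
    moreover have "pat lh f = pat lh' f" using that(1,2) f by (simp add: Mt_def)
    ultimately show ?thesis using pat_inj Fi_sub[OF f] by blast
  qed
  have "separable_decomposition G n m \<Omega> \<phi> \<psi> ?I h q"
    unfolding separable_decomposition_def
  proof (intro conjI allI ballI impI)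
    fix i \<beta> assume i: "i \<le> n"
    show "sos (block m i) (h i \<beta>)"
      unfolding h_def using i V_in by (intro sos_sum sos) (auto simp: Mt_def)
  next
    fix g i \<beta> assume g: "g \<in> carrier G" and i: "i \<le> n" and \<beta>: "\<beta> \<in> ?Fi i \<rightarrow>\<^sub>E ?I"
    let ?\<beta>' = "translate_index G n \<Omega> \<phi> \<psi> g i \<beta>"
    have fwd: "\<psi> g f \<in> ?Fi (\<phi> g i)" if "f \<in> ?Fi i" for f
      using that fst_act[OF g] F_in[OF g] by (auto simp: facet_copies_at_def)
    have bwd: "\<psi> (inv g) f \<in> ?Fi i" if "f \<in> ?Fi (\<phi> g i)" for f
    proof -
      have "\<phi> (inv g) (\<phi> g i) = i" using V.orbit_sym_aux g i by blast
      moreover have f: "f \<in> ?F" "\<phi> g i \<in> fst f" using that by (auto simp: facet_copies_at_def)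
      ultimately have "i \<in> \<phi> (inv g) ` fst f" by (metis imageI)
      then have "i \<in> fst (\<psi> (inv g) f)" using fst_act[of "inv g" f] f g by simp
      then show ?thesis using F_in[of "inv g" f] f g by (simp add: facet_copies_at_def)
    qed
    have cancel: "\<psi> (inv g) (\<psi> g f) = f" if "f \<in> ?F" for f
      using F.orbit_sym_aux g that by blast
    have pat_act: "pat (l, g \<otimes> h) (\<psi> g f) = pat (l, h) f" if "h \<in> carrier G" "f \<in> ?F" for l h f
    proof -
      have "inv g \<otimes> (g \<otimes> z f) = z f" using g z[OF that(2)] by (simp flip: m_assoc)
      then show ?thesis
        using that g z[OF that(2)] by (simp add: pat_def z_act inv_mult_group m_assoc)
    qed
    have iff: "(l, g \<otimes> h) \<in> Mt (\<phi> g i) ?\<beta>' \<longleftrightarrow> (l, h) \<in> Mt i \<beta>" if h: "h \<in> carrier G" for l h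
    proof -
      have "(\<forall>f\<in>?Fi (\<phi> g i). ?\<beta>' f = pat (l, g \<otimes> h) f) \<longleftrightarrow> (\<forall>f\<in>?Fi i. \<beta> f
        = pat (l, h) f)" (is "?A \<longleftrightarrow> ?B")
      proof
        assume A: ?A
        show ?B
        proof
          fix f assume f: "f \<in> ?Fi i"
          have "?\<beta>' (\<psi> g f) = pat (l, g \<otimes> h) (\<psi> g f)" using A fwd[OF f] by blast
          then show "\<beta> f = pat (l, h) f"
            using fwd[OF f] cancel pat_act h Fi_sub[OF f] by (simp add: translate_index_def)
        qed
      next
        assume B: ?B
        show ?A
        proof
          fix f assume f: "f \<in> ?Fi (\<phi> g i)"
          have "\<psi> g (\<psi> (inv g) f) = f"
            using F.orbit_sym_aux[of "inv g" f] g Fi_sub[OF f] by simp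
          then have "pat (l, h) (\<psi> (inv g) f) = pat (l, g \<otimes> h) f"
            using pat_act[OF h, of "\<psi> (inv g) f" l] Fi_sub[OF bwd[OF f]] by simp
          then show "?\<beta>' f = pat (l, g \<otimes> h) f"
            using B bwd[OF f] f by (simp add: translate_index_def)
        qed
      qed
      then show ?thesis using g h by (auto simp: Mt_def)
    qed
    \<comment> \<open>Left multiplication by \<open>g\<close> carries the matches of
      \<open>\<beta>\<close> at \<open>i\<close> to those of its translate at
      \<open>\<phi> g i\<close>. The factor used is the same, since
      \<open>inv (g \<otimes> h) \<otimes> g = inv h\<close>.\<close>
    have "bij_betw (\<lambda>(l, h). (l, g \<otimes> h)) (Mt i \<beta>) (Mt (\<phi> g i) ?\<beta>')"
    proof (rule bij_betw_byWitness[where f' = "\<lambda>(l, h). (l, inv g \<otimes> h)"])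
      have car: "snd lh \<in> carrier G" if "lh \<in> Mt j \<beta>" for lh j \<beta> using that by (auto simp: Mt_def)
      show "\<forall>lh\<in>Mt i \<beta>. (\<lambda>(l, h). (l, inv g \<otimes> h)) ((\<lambda>(l, h). (l, g \<otimes> h)) lh) = lh"
        using car g by (force simp: m_assoc[symmetric])
      show "\<forall>lh\<in>Mt (\<phi> g i) ?\<beta>'. (\<lambda>(l, h). (l, g \<otimes> h)) ((\<lambda>(l, h). (l, inv g \<otimes> h)) lh) = lh"
        using car g by (force simp: m_assoc[symmetric])
      show "(\<lambda>(l, h). (l, g \<otimes> h)) ` Mt i \<beta> \<subseteq> Mt (\<phi> g i) ?\<beta>'"
        using iff car by force
      show "(\<lambda>(l, h). (l, inv g \<otimes> h)) ` Mt (\<phi> g i) ?\<beta>' \<subseteq> Mt i \<beta>"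
      proof clarify
        fix l h assume lh: "(l, h) \<in> Mt (\<phi> g i) ?\<beta>'"
        then have h: "h \<in> carrier G" using car by force
        then have "g \<otimes> (inv g \<otimes> h) = h" using g by (simp add: m_assoc[symmetric])
        then show "(l, inv g \<otimes> h) \<in> Mt i \<beta>" using iff[of "inv g \<otimes> h" l] lh g h by simp
      qed
    qed
    then have "in_block i (h (\<phi> g i) ?\<beta>')
       = (\<Sum>(l, h)\<in>Mt i \<beta>. P l (\<phi> (inv (g \<otimes> h)) (\<phi> g i)) i)"
      unfolding h_def in_block_sum P by (simp add: sum.reindex_bij_betw[symmetric] split_def)
    also have "\<dots> = h i \<beta>"
      unfolding h_def
    proof (intro sum.cong refl, clarify)
      fix l h assume "(l, h) \<in> Mt i \<beta>"
      then have h: "h \<in> carrier G" by (auto simp: Mt_def)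
      have "\<phi> (inv (g \<otimes> h)) (\<phi> g i) = \<phi> (inv (g \<otimes> h) \<otimes> g) i"
        using V.composition_rule[of i "inv (g \<otimes> h)" g] g h i by simp
      also have "inv (g \<otimes> h) \<otimes> g = inv h" using g h by (simp add: inv_mult_group m_assoc)
      finally show "P l (\<phi> (inv (g \<otimes> h)) (\<phi> g i)) i = P (fst (l, h)) (\<phi> (inv (snd (l, h))) i) i"
        by simp
    qed
    finally show "h i \<beta> = in_block i (h (\<phi> g i) ?\<beta>')" by simp
  next
    let ?Q = "\<lambda>lh. \<Prod>i\<le>n. P (fst lh) (\<phi> (inv (snd lh)) i) i"
    have prod: "(\<Prod>i\<le>n. h i (restrict \<alpha> (?Fi i))) = (\<Sum>lh\<in>?L. if \<alpha>
      = restrict (pat lh) ?F then ?Q lh else 0)"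
      if \<alpha>: "\<alpha> \<in> ?F \<rightarrow>\<^sub>E ?I" for \<alpha>
    proof (cases "\<forall>i\<le>n. Mt i (restrict \<alpha> (?Fi i)) \<noteq> {}")
      case True
      define lh where "lh i = (SOME lh. lh \<in> Mt i (restrict \<alpha> (?Fi i)))" for i
      have lh: "lh i \<in> Mt i (restrict \<alpha> (?Fi i))" if "i \<le> n" for i
        using True that unfolding lh_def some_in_eq by blast
      have lhL: "lh i \<in> ?L" if "i \<le> n" for i using lh[OF that] by (simp add: Mt_def)
      have lh_pat: "\<alpha> f = pat (lh i) f" if "i \<le> n" "f \<in> ?Fi i" for i f
        using lh[OF that(1)] that(2) by (simp add: Mt_def)
      have nb: "lh i = lh j" if ij: "(i, j) \<in> neighbours n \<Omega>" for i j
      proof -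
        obtain F where F: "F \<in> facets n \<Omega>" "i \<in> F" "j \<in> F" using ij by (auto simp: neighbours_def)
        then have ij: "i \<le> n" "j \<le> n" by (auto simp: facets_def simplices_def)
        have f: "(F, 0) \<in> ?Fi i" "(F, 0) \<in> ?Fi j"
          using F facet_copy_zero by (auto simp: facet_copies_at_def)
        have "pat (lh i) (F, 0) = pat (lh j) (F, 0)"
          using lh_pat[OF ij(1) f(1)] lh_pat[OF ij(2) f(2)] by simp
        then show ?thesis
          by (rule pat_inj[OF lhL[OF ij(1)] lhL[OF ij(2)] Fi_sub[OF f(1)]])
      qed
      have "lh i = lh j" if "(i, j) \<in> (neighbours n \<Omega>)\<^sup>*" for i j
        using that by induction (auto dest: nb)
      then have const: "lh i = lh 0" if "i \<le> n" for i
        using conn that by (auto simp: connected_complex_def)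
      have pat0: "\<alpha> f = pat (lh 0) f" if "f \<in> ?F" for f
        using facet_copies_cover[OF W that] lh_pat const by metis
      then have \<alpha>_eq: "\<alpha> = restrict (pat (lh 0)) ?F"
        using \<alpha> by (auto simp: fun_eq_iff PiE_iff extensional_def)
      have other: "lh' = lh 0" if "lh' \<in> ?L" "\<alpha> = restrict (pat lh') ?F" for lh'
      proof -
        obtain f where f: "f \<in> ?F" using facet_copies_at_nonempty[OF W, of 0] Fi_sub by blast
        have "pat lh' f = pat (lh 0) f" using pat0[OF f] f that(2) by simp
        then show ?thesis using pat_inj[OF that(1) lhL f] by simp
      qed
      have "h i (restrict \<alpha> (?Fi i))
        = P (fst (lh 0)) (\<phi> (inv (snd (lh 0))) i) i" if i: "i \<le> n" for i
      proof -
        have "Mt i (restrict \<alpha> (?Fi i)) = {lh 0}"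
          using lh[OF i] const[OF i] Mt_unique[OF _ _ i]
            by (metis singletonI subsetI subset_singletonD empty_iff insertE equals0D)
        then show ?thesis by (simp add: h_def)
      qed
      then have "(\<Prod>i\<le>n. h i (restrict \<alpha> (?Fi i))) = ?Q (lh 0)" by simp
      also have "\<dots> = (\<Sum>lh'\<in>?L. if lh' = lh 0 then ?Q lh' else 0)"
        using lhL[of 0] fin by simp
      also have "\<dots> = (\<Sum>lh'\<in>?L. if \<alpha> = restrict (pat lh') ?F then ?Q lh' else 0)"
        using other \<alpha>_eq by (intro sum.cong refl if_cong) auto
      finally show ?thesis .
    next
      case False
      then obtain i where i: "i \<le> n" "Mt i (restrict \<alpha> (?Fi i)) = {}" by blast
      then have "h i (restrict \<alpha> (?Fi i)) = 0" by (simp add: h_def)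
      then have "(\<Prod>i\<le>n. h i (restrict \<alpha> (?Fi i))) = 0" using i(1) by (intro prod_zero) auto
      moreover have "\<alpha> \<noteq> restrict (pat lh) ?F" if "lh \<in> ?L" for lh
      proof
        assume "\<alpha> = restrict (pat lh) ?F"
        then have "lh \<in> Mt i (restrict \<alpha> (?Fi i))"
          using \<open>lh \<in> ?L\<close> Fi_sub by (simp add: Mt_def)
        then show False using i(2) by simp
      qed
      ultimately show ?thesis by (simp add: sum.neutral)
    qed
    have pat_in: "restrict (pat lh) ?F \<in> ?F \<rightarrow>\<^sub>E ?I" if "lh \<in> ?L" for lh
    proof -
      have "pat lh f \<in> ?I" if f: "f \<in> ?F" for f
        using bij_betwE[OF e] z[OF f] \<open>lh \<in> ?L\<close> by (auto simp: pat_def)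
      then show ?thesis by auto
    qed
    have "(\<Sum>\<alpha>\<in>?F \<rightarrow>\<^sub>E ?I. \<Prod>i\<le>n. h i (restrict \<alpha> (?Fi i)))
      = (\<Sum>\<alpha>\<in>?F \<rightarrow>\<^sub>E ?I. \<Sum>lh\<in>?L. if \<alpha> = restrict (pat lh) ?F then ?Q lh else 0)"
      using prod by (rule sum.cong[OF refl])
    also have "\<dots> = (\<Sum>lh\<in>?L. \<Sum>\<alpha>\<in>?F \<rightarrow>\<^sub>E ?I. if \<alpha> = restrict (pat lh) ?F then ?Q lh else 0)"
      by (rule sum.swap)
    \<comment> \<open>Every pattern is itself one of the admissible \<open>\<alpha>\<close>, so
      exactly one term of each inner sum survives.\<close>
    also have "\<dots> = (\<Sum>lh\<in>?L. ?Q lh)"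
      using pat_in finite_facet_copies by (intro sum.cong refl) (simp add: finite_PiE)
    also have "\<dots> = q" by (simp add: q sum.cartesian_product split_def)
    finally show "q = (\<Sum>\<alpha>\<in>?F \<rightarrow>\<^sub>E ?I. \<Prod>i\<le>n. h i (restrict \<alpha> (?Fi i)))" by simp
  qed simp
  then have "enat (card ?I) \<in> {enat (card I) | (I :: nat set) h. separable_decomposition G n m \<Omega> \<phi>
    \<psi> I h q}"
    by blast
  then have "sep_rank G n m \<Omega> \<phi> \<psi> q \<le> enat (card ?I)"
    unfolding sep_rank_def by (rule Inf_lower)
  then show ?thesis by simp
qed

section \<open>Gram matrices of separable polynomials\<close>

lemma poly_bound_constant_term:
  fixes Q :: "real poly"
  assumes "\<And>t. 0 < t \<Longrightarrow> t < 1 \<Longrightarrow> \<bar>poly Q t\<bar> \<le> C * t"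
  shows "coeff Q 0 = 0"
proof -
  have "(poly Q \<longlongrightarrow> poly Q 0) (at_right 0)"
    by (intro tendsto_intros filterlim_ident[THEN tendsto_poly] tendsto_ident_at)
  moreover have "(poly Q \<longlongrightarrow> 0) (at_right 0)"
  proof (rule Lim_null_comparison)
    show "\<forall>\<^sub>F t in at_right 0. norm (poly Q t) \<le> C * t"
      using assms by (auto simp: eventually_at_right_field intro!: exI[of _ 1])
    show "((\<lambda>t. C * t) \<longlongrightarrow> 0) (at_right 0)"
      by (rule tendsto_eq_intros | simp)+
  qed
  ultimately have "poly Q 0 = 0" by (rule tendsto_unique[rotated]) simp
  then show ?thesis by (simp add: poly_0_coeff_0)
qed

text \<open>Near 0 the bound excludes terms of degree below \<open>d\<close>, and near infinity
  those above \<open>d\<close>. The second case becomes the first by reversing the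
  coefficients.\<close>

lemma poly_bound_power:
  fixes P :: "real poly"
  assumes bound: "\<And>t. \<bar>poly P t\<bar> \<le> C * \<bar>t\<bar> ^ d"
  shows "P = monom (coeff P d) d"
proof (cases "P = 0")
  case False
  have C: "0 \<le> C" using bound[of 1] by simp
  have pw: "t ^ e \<le> t" if "0 < t" "t < 1" "0 < e" for t :: real and e
    using power_decreasing[of 1 e t] that by simp
  have low: "d \<le> order 0 P"
  proof (rule ccontr)
    assume "\<not> d \<le> order 0 P"
    define k where "k = order 0 P"
    have k: "k < d" using \<open>\<not> d \<le> order 0 P\<close> by (simp add: k_def)
    obtain Q where Q: "P = [:- 0, 1:] ^ k * Q" "\<not> [:- 0, 1:] dvd Q"
      using order_decomp[OF False, of 0] unfolding k_def by blast
    have "coeff Q 0 = 0"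
    proof (rule poly_bound_constant_term)
      fix t :: real assume t: "0 < t" "t < 1"
      have "t ^ k * \<bar>poly Q t\<bar> = \<bar>poly P t\<bar>" using t by (simp add: Q(1) abs_mult)
      also have "\<dots> \<le> C * t ^ d" using bound[of t] t by simp
      also have "t ^ d = t ^ k * t ^ (d - k)" using k by (simp flip: power_add)
      finally have "t ^ k * \<bar>poly Q t\<bar> \<le> t ^ k * (C * t ^ (d - k))" by (simp add: mult_ac)
      then have "\<bar>poly Q t\<bar> \<le> C * t ^ (d - k)" using t by simp
      also have "\<dots> \<le> C * t" using C t k by (intro mult_left_mono pw) auto
      finally show "\<bar>poly Q t\<bar> \<le> C * t" .
    qed
    then have "poly Q 0 = 0" by (simp add: poly_0_coeff_0)
    then show False using Q(2) by (simp add: poly_eq_0_iff_dvd)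
  qed
  have high: "degree P \<le> d"
  proof (rule ccontr)
    assume N: "\<not> degree P \<le> d"
    have "coeff (reflect_poly P) 0 = 0"
    proof (rule poly_bound_constant_term)
      fix t :: real assume t: "0 < t" "t < 1"
      have "\<bar>poly (reflect_poly P) t\<bar> = t ^ degree P * \<bar>poly P (inverse t)\<bar>"
        using t by (simp add: poly_reflect_poly_nz abs_mult)
      also have "\<dots> \<le> t ^ degree P * (C * \<bar>inverse t\<bar> ^ d)"
        using t by (intro mult_left_mono bound) auto
      also have "\<dots> = C * t ^ (degree P - d)"
        using t N by (simp add: power_diff field_simps)
      also have "\<dots> \<le> C * t" using C t N by (intro mult_left_mono pw) auto
      finally show "\<bar>poly (reflect_poly P) t\<bar> \<le> C * t" .
    qed
    \<comment> \<open>The constant term of the reflected polynomial is the leading coefficient of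
      \<open>P\<close>.\<close>
    then show False using False by simp
  qed
  have "coeff P e = 0" if "e \<noteq> d" for e
  proof (cases "e < d")
    case True
    have "monom 1 d dvd P" using low False by (simp add: monom_1_dvd_iff)
    then show ?thesis using True by (simp add: monom_1_dvd_iff')
  next
    case False
    then show ?thesis using high that by (intro coeff_eq_0) auto
  qed
  then show ?thesis by (intro poly_eqI) auto
qed simp

text \<open>If no factor is the zero polynomial, all arguments but one can be fixed where their
  factors do not vanish; dividing by these values leaves a power bound for the remaining factor,
  which is thus a monomial.\<close>

lemma prod_poly_bound_power:
  fixes P :: "'i \<Rightarrow> real poly"
  assumes I: "finite I"
    and bound: "\<And>t. (\<Prod>i\<in>I. poly (P i) (t i))\<^sup>2 \<le> C * (\<Prod>i\<in>I. t i ^ (2 * d))"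
  shows "(\<Prod>i\<in>I. poly (P i) 1) = (\<Prod>i\<in>I. coeff (P i) d)"
proof (cases "\<exists>i\<in>I. P i = 0")
  case True
  then obtain i where "i \<in> I" "P i = 0" by blast
  then show ?thesis
    using I prod_zero[of I "\<lambda>i. poly (P i) 1"] prod_zero[of I "\<lambda>i. coeff (P i) d"]
    by (metis coeff_0 poly_0)
next
  case False
  then have "\<exists>t. poly (P i) t \<noteq> 0" if "i \<in> I" for i
    using that poly_all_0_iff_0 by blast
  then obtain \<tau> where \<tau>: "\<And>i. i \<in> I \<Longrightarrow> poly (P i) (\<tau> i) \<noteq> 0" by metis
  have "poly (P j) 1 = coeff (P j) d" if j: "j \<in> I" for j
  proof -
    define K where "K = (\<Prod>i\<in>I - {j}. poly (P i) (\<tau> i))"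
    define L where "L = C * (\<Prod>i\<in>I - {j}. \<tau> i ^ (2 * d))"
    have K: "K \<noteq> 0" using \<tau> I by (auto simp: K_def)
    have b: "\<bar>poly (P j) s\<bar> \<le> sqrt (\<bar>L\<bar> / K\<^sup>2) * \<bar>s\<bar> ^ d" for s
    proof -
      have "(poly (P j) s * K)\<^sup>2 = (\<Prod>i\<in>I. poly (P i) ((\<tau>(j := s)) i))\<^sup>2"
        unfolding K_def prod.remove[OF I j] by simp
      also have "\<dots> \<le> C * (\<Prod>i\<in>I. (\<tau>(j := s)) i ^ (2 * d))" by (rule bound)
      also have "\<dots> = L * s ^ (2 * d)"
        unfolding L_def prod.remove[OF I j] by simp
      also have "\<dots> \<le> \<bar>L\<bar> * s ^ (2 * d)" by (intro mult_right_mono) auto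
      finally have "(poly (P j) s)\<^sup>2 \<le> \<bar>L\<bar> / K\<^sup>2 * s ^ (2 * d)"
        using K by (simp add: power_mult_distrib field_simps)
      also have "\<dots> = (sqrt (\<bar>L\<bar> / K\<^sup>2) * \<bar>s\<bar> ^ d)\<^sup>2"
        by (simp add: power_mult_distrib power_mult power2_commute flip: power_mult)
          (simp add: mult.commute power_even_abs)
      finally have "\<bar>poly (P j) s\<bar> \<le> \<bar>sqrt (\<bar>L\<bar> / K\<^sup>2) * \<bar>s\<bar> ^ d\<bar>"
        by (simp only: abs_le_square_iff)
      then show ?thesis by (simp add: abs_mult)
    qed
    have "P j = monom (coeff (P j) d) d" by (rule poly_bound_power[OF b])
    then show ?thesis by (metis mult.right_neutral poly_monom power_one)
  qed
  then show ?thesis by simp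
qed

lemma poly_eval_scale_blocks:
  assumes "p \<in> homogeneous_polys n m e"
  shows "poly_eval (\<lambda>(i, k). t i * x i k) p = (\<Prod>i\<le>n. t i ^ e) * poly_eval (\<lambda>(i, k). x i k) p"
proof -
  let ?V = "{..n} \<times> {..m}"
  have "monom_eval (\<lambda>(i, k). t i * x i k) u = (\<Prod>i\<le>n. t i ^ e) * monom_eval (\<lambda>(i, k). x i k) u"
    if u: "u \<in> Poly_Mapping.keys p" for u
  proof -
    have V: "Poly_Mapping.keys u \<subseteq> ?V" and deg: "\<And>i. i \<le> n
      \<Longrightarrow> (\<Sum>k\<le>m. Poly_Mapping.lookup u (i, k)) = e"
      using assms u by (auto simp: homogeneous_polys_def polys_in_def)
    have "monom_eval (\<lambda>(i, k). t i * x i k) u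
       = (\<Prod>i\<le>n. \<Prod>k\<le>m. (t i * x i k) ^ Poly_Mapping.lookup u (i, k))"
      using V by (simp add: monom_eval_superset[of ?V] prod.cartesian_product split_def)
    also have "\<dots> = (\<Prod>i\<le>n. t i ^ (\<Sum>k\<le>m. Poly_Mapping.lookup u (i, k)))
         * (\<Prod>i\<le>n. \<Prod>k\<le>m. x i k ^ Poly_Mapping.lookup u (i, k))"
      by (simp add: power_mult_distrib prod.distrib power_sum)
    also have "(\<Prod>i\<le>n. t i ^ (\<Sum>k\<le>m. Poly_Mapping.lookup u (i, k))) = (\<Prod>i\<le>n. t i ^ e)"
      by (intro prod.cong refl) (simp add: deg)
    also have "(\<Prod>i\<le>n. \<Prod>k\<le>m. x i k ^ Poly_Mapping.lookup u (i, k)) = monom_eval (\<lambda>(i, k). x i k) u"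
      using V by (simp add: monom_eval_superset[of ?V] prod.cartesian_product split_def)
    finally show ?thesis .
  qed
  then show ?thesis
    by (simp add: poly_eval_superset[OF finite_keys order_refl] sum_distrib_left mult_ac)
qed

text \<open>The coefficient in \<open>u\<close> of the monomial \<open>s\<close> written in the
  variables of block \<open>i\<close>. For \<open>u\<close> in these variables at most one
  \<open>t\<close> contributes; the sum over the fibre of \<open>map_key\<close> suits the
  regrouping of the terms of \<open>u\<close>.\<close>

definition block_coeff :: "nat \<Rightarrow> (nat \<times> nat) rpoly \<Rightarrow> (nat \<Rightarrow>\<^sub>0 nat) \<Rightarrow> real" where
  "block_coeff i u s = (\<Sum>t\<in>{t \<in> Poly_Mapping.keys u. Poly_Mapping.map_key (Pair i) t
    = s}. Poly_Mapping.lookup u t)"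

text \<open>Scaling the variables of a block turns \<open>u\<close> into a univariate polynomial
  whose coefficient at \<open>d\<close> is the part of \<open>u\<close> of degree \<open>d\<close>.
  The scalars \<open>\<tau>\<close> are given for all blocks, so that one scaled point serves all
  factors of a product.\<close>

lemma block_scaling:
  assumes u: "u \<in> polys_in (block m i)"
  shows "\<exists>P. (\<forall>\<tau>. poly P (\<tau> i) = poly_eval (\<lambda>(j, k). \<tau> j * x j k) u) \<and>
    coeff P d = (\<Sum>s\<in>monomials m d. block_coeff i u s * (\<Prod>k\<le>m. x i k ^ Poly_Mapping.lookup s k))"
proof -
  let ?\<pi> = "Poly_Mapping.map_key (Pair i) :: (nat \<times> nat \<Rightarrow>\<^sub>0 nat) \<Rightarrow> _"
  let ?K = "Poly_Mapping.keys u"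
  have inj: "inj (Pair i)" by (auto intro: injI)
  have look: "Poly_Mapping.lookup (?\<pi> t) k = Poly_Mapping.lookup t (i, k)" for t k
    by (simp add: map_key.rep_eq[OF inj])
  define D where "D t = (\<Sum>k\<le>m. Poly_Mapping.lookup t (i, k))" for t :: "nat \<times> nat \<Rightarrow>\<^sub>0 nat"
  define w where "w t = (\<Prod>k\<le>m. x i k ^ Poly_Mapping.lookup t (i, k))" for t
  have keys: "Poly_Mapping.keys t \<subseteq> block m i" if "t \<in> ?K" for t
    using u that by (auto simp: polys_in_def)
  define P where "P = (\<Sum>t\<in>?K. monom (Poly_Mapping.lookup u t * w t) (D t))"
  have "poly P (\<tau> i) = poly_eval (\<lambda>(j, k). \<tau> j * x j k) u" for \<tau>
  proof -
    have "monom_eval (\<lambda>(j, k). \<tau> j * x j k) t = \<tau> i ^ D t * w t" if "t \<in> ?K" for t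
    proof -
      have "monom_eval (\<lambda>(j, k). \<tau> j * x j k) t
        = (\<Prod>jk\<in>{i} \<times> {..m}. (\<lambda>(j, k). \<tau> j * x j k) jk ^ Poly_Mapping.lookup t jk)"
        using keys[OF that] by (intro monom_eval_superset) (auto simp: block_def)
      also have "\<dots> = (\<Prod>j\<in>{i}. \<Prod>k\<le>m. (\<tau> j * x j k) ^ Poly_Mapping.lookup t (j, k))"
        by (simp only: prod.cartesian_product split_def fst_conv snd_conv prod.collapse)
      finally show ?thesis
        by (simp add: power_mult_distrib prod.distrib power_sum D_def w_def)
    qed
    then show ?thesis
      by (simp add: P_def poly_sum poly_monom poly_eval_superset[OF finite_keys order_refl] mult_ac)
  qed
  moreover have "coeff P d = (\<Sum>s\<in>monomials m d. block_coeff i u s * (\<Prod>k\<le>m. x i k ^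
    Poly_Mapping.lookup s k))"
  proof -
    let ?T = "{t \<in> ?K. D t = d}"
    have mono: "?\<pi> t \<in> monomials m d \<longleftrightarrow> D t = d" if "t \<in> ?K" for t
      using keys[OF that] by (auto simp: monomials_def look D_def keys_map_key[OF inj] block_def)
    have "coeff P d = (\<Sum>t\<in>?K. if D t = d then Poly_Mapping.lookup u t * w t else 0)"
      by (simp add: P_def coeff_sum)
    also have "\<dots> = (\<Sum>t\<in>?T. Poly_Mapping.lookup u t * w t)"
      by (simp add: sum.inter_filter)
    also have "\<dots> = (\<Sum>s\<in>monomials m d. \<Sum>t\<in>{t \<in> ?T. ?\<pi> t = s}. Poly_Mapping.lookup u t * w t)"
      using mono by (intro sum.group[symmetric]) auto
    also have "\<dots> = (\<Sum>s\<in>monomials m d. block_coeff i u s * (\<Prod>k\<le>m. x i k ^ Poly_Mapping.lookup s k))"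
    proof (intro sum.cong refl)
      fix s assume s: "s \<in> monomials m d"
      have "{t \<in> ?T. ?\<pi> t = s} = {t \<in> ?K. ?\<pi> t = s}" using s mono by auto
      moreover have "w t = (\<Prod>k\<le>m. x i k ^ Poly_Mapping.lookup s k)" if "?\<pi> t = s" for t
        using that by (auto simp: w_def look)
      ultimately show "(\<Sum>t\<in>{t \<in> ?T. ?\<pi> t = s}. Poly_Mapping.lookup u t * w t)
        = block_coeff i u s * (\<Prod>k\<le>m. x i k ^ Poly_Mapping.lookup s k)"
        by (simp add: block_coeff_def sum_distrib_right)
    qed
    finally show ?thesis .
  qed
  ultimately show ?thesis by blast
qed

lemma psd_matrix_rank_one: "psd_matrix X (\<lambda>s t. v s * v t)"
proof -
  have "(\<Sum>s\<in>X. \<Sum>t\<in>X. y s * (v s * v t) * y t) = (\<Sum>s\<in>X. y s * v s)\<^sup>2" for y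
    by (simp add: power2_eq_square sum_product mult_ac)
  then show ?thesis by (simp add: psd_matrix_def mult.commute)
qed

text \<open>Each product of squares in the expansion of \<open>p\<close> is bounded by \<open>p\<close>. Scaling the blocks then
  shows that only the degree \<open>d\<close> parts of its factors contribute.\<close>

lemma separable_poly_gram:
  assumes hom: "p \<in> homogeneous_polys n m (2 * d)" and sep: "separable_poly n m p"
  shows "\<exists>(r::nat) A. (\<forall>j<r. \<forall>i\<le>n. psd_matrix (monomials m d) (A j i)) \<and>
    p = gram_map n m d (\<lambda>a b. \<Sum>j<r. tensor_matrix n (A j) a b)"
proof -
  obtain r :: nat and h where h: "\<And>j i. j < r \<Longrightarrow> i \<le> n \<Longrightarrow> sos (block m i) (h j i)"
    and p: "p = (\<Sum>j<r. \<Prod>i\<le>n. h j i)"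
    using sep unfolding separable_poly_def by blast
  have "\<exists>(s::nat) u. j < r \<longrightarrow> i \<le> n \<longrightarrow> (\<forall>l<s. u l \<in> polys_in (block m i)) \<and> h j i
    = (\<Sum>l<s. u l ^ 2)" for j i
    using h[of j i] unfolding sos_def by blast
  then obtain s :: "nat \<Rightarrow> nat \<Rightarrow> nat" and u where
    u: "\<And>j i l. j < r \<Longrightarrow> i \<le> n \<Longrightarrow> l < s j i \<Longrightarrow> u j i l \<in> polys_in (block m i)"
    and hu: "\<And>j i. j < r \<Longrightarrow> i \<le> n \<Longrightarrow> h j i = (\<Sum>l<s j i. u j i l ^ 2)"
    by metis
  let ?Ls = "\<lambda>j. PiE {..n} (\<lambda>i. {..<s j i})"
  \<comment> \<open>Expanding the products of sums of squares: an index is a summand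
    \<open>j\<close> together with one square from each of its factors.\<close>
  define J where "J = Sigma {..<r} ?Ls"
  have J: "finite J" by (simp add: J_def finite_PiE)
  define U where "U = (\<lambda>(j, L) x. \<Prod>i\<le>n. poly_eval x (u j i (L i)))"
  have eval_p: "poly_eval x p = (\<Sum>jL\<in>J. (U jL x)\<^sup>2)" for x
  proof -
    have "poly_eval x p = (\<Sum>j<r. \<Prod>i\<le>n. \<Sum>l<s j i. (poly_eval x (u j i l))\<^sup>2)"
      unfolding p poly_eval_sum poly_eval_prod
      by (intro sum.cong prod.cong refl) (simp add: hu poly_eval_hom)
    also have "\<dots> = (\<Sum>j<r. \<Sum>L\<in>?Ls j. \<Prod>i\<le>n. (poly_eval x (u j i (L i)))\<^sup>2)"
      by (intro sum.cong refl prod_sum_PiE) auto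
    also have "\<dots> = (\<Sum>jL\<in>J. (U jL x)\<^sup>2)"
      unfolding J_def by (subst sum.Sigma) (auto simp: U_def finite_PiE prod_power_distrib intro!:
        sum.cong)
    finally show ?thesis .
  qed
  \<comment> \<open>The coefficient vectors of the factors; restricted to monomials of degree
    \<open>d\<close> they describe the degree \<open>d\<close> parts and yield rank one
    matrices.\<close>
  define v where "v = (\<lambda>(j, L) i. block_coeff i (u j i (L i)))"
  define A where "A jL i s t = v jL i s * v jL i t" for jL i s t
  have U_v: "U jL x = (\<Prod>i\<le>n. \<Sum>s\<in>monomials m d. v jL i s * (\<Prod>k\<le>m. x (i, k) ^ Poly_Mapping.lookup s
    k))"
    if jL: "jL \<in> J" for jL x
  proof -
    obtain j L where [simp]: "jL = (j, L)" by (metis surj_pair)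
    have jL': "j < r" "\<And>i. i \<le> n \<Longrightarrow> L i < s j i" using jL by (auto simp: J_def PiE_iff)
    let ?x = "\<lambda>i k. x (i, k)"
    have "\<forall>i\<in>{..n}. \<exists>P. (\<forall>\<tau>. poly P (\<tau> i) = poly_eval (\<lambda>(j, k). \<tau> j * ?x j k) (u j i (L i))) \<and>
      coeff P d = (\<Sum>s\<in>monomials m d. block_coeff i (u j i (L i)) s * (\<Prod>k\<le>m. ?x i k ^
        Poly_Mapping.lookup s k))"
      by (intro ballI block_scaling u jL') auto
    from bchoice[OF this] obtain P where P: "\<And>i \<tau>. i \<le> n
      \<Longrightarrow> poly (P i) (\<tau> i) = poly_eval (\<lambda>(j, k). \<tau> j * ?x j k) (u j i (L i))"
      and P_coeff: "\<And>i. i \<le> n \<Longrightarrow> coeff (P i) d = (\<Sum>s\<in>monomials m d. block_coeff i (u j i (L i)) s *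
        (\<Prod>k\<le>m. ?x i k ^ Poly_Mapping.lookup s k))"
      unfolding Ball_def atMost_iff by blast
    have "(\<Prod>i\<le>n. poly (P i) 1) = (\<Prod>i\<le>n. coeff (P i) d)"
    proof (rule prod_poly_bound_power)
      fix t
      let ?y = "\<lambda>(i, k). t i * ?x i k"
      have "(\<Prod>i\<le>n. poly (P i) (t i)) = U jL ?y"
        by (simp add: U_def P)
      then have "(\<Prod>i\<le>n. poly (P i) (t i))\<^sup>2 \<le> poly_eval ?y p"
        unfolding eval_p using member_le_sum[OF jL, of "\<lambda>jL. (U jL ?y)\<^sup>2"] J by simp
      also have "\<dots> = poly_eval x p * (\<Prod>i\<le>n. t i ^ (2 * d))"
        using poly_eval_scale_blocks[OF hom, of t ?x] by (simp add: mult.commute split_def)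
      finally show "(\<Prod>i\<le>n. poly (P i) (t i))\<^sup>2 \<le> poly_eval x p * (\<Prod>i\<le>n. t i ^ (2 * d))" .
    qed simp
    moreover have "U jL x = (\<Prod>i\<le>n. poly (P i) 1)"
      unfolding U_def using P[of _ "\<lambda>_. 1"] by (simp add: split_def)
    ultimately show ?thesis by (simp add: P_coeff v_def)
  qed
  have p_gram: "p = gram_map n m d (\<lambda>a b. \<Sum>jL\<in>J. tensor_matrix n (A jL) a b)"
  proof (rule poly_eval_inject)
    fix x
    have "(U jL x)\<^sup>2 = poly_eval x (gram_map n m d (tensor_matrix n (A jL)))" if "jL \<in> J" for jL
      unfolding U_v[OF that] gram_map_tensor_matrix poly_eval_prod poly_eval_block_form
        prod_power_distrib
      by (simp add: A_def power2_eq_square sum_product mult_ac)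
    then show "poly_eval x p = poly_eval x (gram_map n m d (\<lambda>a b. \<Sum>jL\<in>J. tensor_matrix n (A jL) a
      b))"
      by (simp add: eval_p gram_map_sum poly_eval_sum)
  qed
  obtain f where f: "bij_betw f {0..<card J} J" using ex_bij_betw_nat_finite[OF J] by blast
  have "p = gram_map n m d (\<lambda>a b. \<Sum>j<card J. tensor_matrix n (A (f j)) a b)"
    unfolding p_gram lessThan_atLeast0 using f by (subst sum.reindex_bij_betw[OF f]) simp
  moreover have "psd_matrix (monomials m d) (A (f j) i)" for j i
    unfolding A_def by (rule psd_matrix_rank_one)
  ultimately show ?thesis by (intro exI[of _ "card J"] exI[of _ "\<lambda>j. A (f j)"]) blast
qed

section \<open>The approximation theorem\<close>

lemma act_poly_sum: "act_poly \<phi> g (\<Sum>j\<in>J. p j) = (\<Sum>j\<in>J. act_poly \<phi> g (p j))"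
  by (rule poly_eval_inject) (simp add: poly_eval_act_poly poly_eval_sum)

lemma tensor_matrix_cong:
  "(\<And>i. i \<le> n \<Longrightarrow> A i (a i) (b i) = B i (a' i) (b' i))
    \<Longrightarrow> tensor_matrix n A a b = tensor_matrix n B a' b'"
  by (simp add: tensor_matrix_def)

text \<open>The action moves the factor of block \<open>i\<close> to block
  \<open>\<phi> g i\<close>; read from the target block, this is the inverse permutation.\<close>

lemma act_poly_gram_map_tensor:
  fixes G (structure)
  assumes "group_action G {..n} \<phi>" "g \<in> carrier G"
  shows "act_poly \<phi> g (gram_map n m d (tensor_matrix n A))
     = gram_map n m d (tensor_matrix n (\<lambda>i. A (\<phi> (inv g) i)))"
proof (rule poly_eval_inject)
  fix x :: "nat \<times> nat \<Rightarrow> real"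
  interpret group_action G "{..n}" \<phi> by fact
  have bij: "bij_betw (\<phi> g) {..n} {..n}"
    using inj_prop surj_prop assms(2) by (simp add: bij_betw_def)
  have inv: "\<phi> (inv g) (\<phi> g i) = i" if "i \<in> {..n}" for i
    using orbit_sym_aux assms(2) that by blast
  have "poly_eval x (act_poly \<phi> g (gram_map n m d (tensor_matrix n A)))
     = (\<Prod>i\<le>n. poly_eval x (block_form m d (\<phi> g i) (A (\<phi> (inv g) (\<phi> g i)))))"
    by (simp add: poly_eval_act_poly gram_map_tensor_matrix poly_eval_prod poly_eval_block_form inv)
  also have "\<dots> = (\<Prod>i\<le>n. poly_eval x (block_form m d i (A (\<phi> (inv g) i))))"
    by (rule prod.reindex_bij_betw[OF bij])
  finally show "poly_eval x (act_poly \<phi> g (gram_map n m d (tensor_matrix n A)))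
     = poly_eval x (gram_map n m d (tensor_matrix n (\<lambda>i. A (\<phi> (inv g) i))))"
    by (simp add: gram_map_tensor_matrix poly_eval_prod)
qed

text \<open>The factors are permuted exactly as under \<open>act_poly\<close>, so symmetrising
  matrices corresponds to symmetrising polynomials.\<close>

lemma tensor_matrix_permute:
  fixes G (structure)
  assumes "group_action G {..n} \<phi>" "g \<in> carrier G"
  shows "tensor_matrix n A (\<lambda>i\<in>{..n}. a (\<phi> g i)) (\<lambda>i\<in>{..n}. b (\<phi> g i))
     = tensor_matrix n (\<lambda>i. A (\<phi> (inv g) i)) a b"
proof -
  interpret group_action G "{..n}" \<phi> by fact
  have bij: "bij_betw (\<phi> g) {..n} {..n}"
    using inj_prop surj_prop assms(2) by (simp add: bij_betw_def)
  have inv: "\<phi> (inv g) (\<phi> g i) = i" if "i \<in> {..n}" for i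
    using orbit_sym_aux assms(2) that by blast
  have "tensor_matrix n A (\<lambda>i\<in>{..n}. a (\<phi> g i)) (\<lambda>i\<in>{..n}. b (\<phi> g i))
     = (\<Prod>i\<le>n. A (\<phi> (inv g) (\<phi> g i)) (a (\<phi> g i)) (b (\<phi> g i)))"
    by (simp add: tensor_matrix_def inv)
  also have "\<dots> = tensor_matrix n (\<lambda>i. A (\<phi> (inv g) i)) a b"
    unfolding tensor_matrix_def by (rule prod.reindex_bij_betw[OF bij])
  finally show ?thesis .
qed

lemma separable_matrix_sum:
  assumes J: "finite J" and A: "\<And>j i. j \<in> J \<Longrightarrow> i \<le> n \<Longrightarrow> psd_matrix X (A j i)"
  shows "separable_matrix n X (\<lambda>a b. \<Sum>j\<in>J. tensor_matrix n (A j) a b)"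
proof -
  obtain f where f: "bij_betw f {0..<card J} J" using ex_bij_betw_nat_finite[OF J] by blast
  have "(\<Sum>j\<in>J. tensor_matrix n (A j) a b) = (\<Sum>j<card J. tensor_matrix n (A (f j)) a b)" for a b
    unfolding lessThan_atLeast0 by (simp add: sum.reindex_bij_betw[OF f, symmetric])
  moreover have "psd_matrix X (A (f j) i)" if "j < card J" "i \<le> n" for j i
    using A bij_betwE[OF f] that by simp
  ultimately show ?thesis unfolding separable_matrix_def
    by (intro exI[of _ "card J"] exI[of _ "\<lambda>j. A (f j)"]) simp
qed

text \<open>Summing the permuted Gram matrices over the group gives an invariant one, which
  represents \<open>|G|\<close> copies of the invariant \<open>p\<close>. This makes the infimum in
  the gauge one over a nonempty set.\<close>

lemma sep_gauge_feasible:
  fixes G (structure)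
  assumes "group_action G {..n} \<phi>" and fin: "finite (carrier G)"
    and hom: "p \<in> homogeneous_polys n m (2 * d)" and sep: "separable_poly n m p"
    and inv_p: "invariant_poly G \<phi> p"
  shows "\<exists>l>0. \<exists>M\<in>SEP n (monomials m d).
     invariant_matrix G n \<phi> (monomials m d) M \<and> p = poly_const l * gram_map n m d M"
proof -
  interpret group_action G "{..n}" \<phi> by fact
  interpret group G using group_hom group_hom.axioms(1) by auto
  let ?X = "monomials m d"
  obtain r :: nat and A where A: "\<And>j i. j < r \<Longrightarrow> i \<le> n \<Longrightarrow> psd_matrix ?X (A j i)"
    and pA: "p = gram_map n m d (\<lambda>a b. \<Sum>j<r. tensor_matrix n (A j) a b)"
    using separable_poly_gram[OF hom sep] by blast
  have V_in: "\<phi> g i \<le> n" if "g \<in> carrier G" "i \<le> n" for g i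
    using element_image[of g i] that by auto
  let ?J = "carrier G \<times> {..<r}"
  define B where "B = (\<lambda>(g, j) i. A j (\<phi> (inv g) i))"
  have B: "psd_matrix ?X (B gj i)" if "gj \<in> ?J" "i \<le> n" for gj i
    using that A V_in by (auto simp: B_def)
  define M0 where "M0 a b = (\<Sum>gj\<in>?J. tensor_matrix n (B gj) a b)" for a b
  define T where "T = matrix_trace n ?X M0"
  have T: "0 \<le> T"
    unfolding T_def M0_def matrix_trace_sum
    using B by (intro sum_nonneg tensor_matrix_trace_nonneg) auto
  have gram_M0: "gram_map n m d M0 = poly_const (real (card (carrier G))) * p"
  proof -
    have "gram_map n m d M0 = (\<Sum>g\<in>carrier G. \<Sum>j<r. gram_map n m d (tensor_matrix n (B (g, j))))"
      unfolding M0_def gram_map_sum by (simp add: sum.cartesian_product)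
    also have "\<dots> = (\<Sum>g\<in>carrier G. act_poly \<phi> g p)"
      unfolding pA gram_map_sum act_poly_sum
      by (intro sum.cong refl) (simp add: B_def act_poly_gram_map_tensor[OF assms(1)])
    also have "\<dots> = (\<Sum>g\<in>carrier G. p)" using inv_p by (simp add: invariant_poly_def)
    finally show ?thesis
      by (intro poly_eval_inject, simp only: poly_eval_sum poly_eval_mult poly_eval_const) simp
  qed
  have card: "0 < card (carrier G)" using fin one_closed by (auto simp: card_gt_0_iff)
  \<comment> \<open>Dividing by \<open>T + 1\<close> keeps the trace at most 1 and also covers a
    vanishing trace \<open>T\<close>.\<close>
  define M where "M a b = 1 / (T + 1) * M0 a b" for a b
  have M_sum: "M = (\<lambda>a b. \<Sum>gj\<in>?J. tensor_matrix n (\<lambda>i s t. root (Suc n) (1 / (T + 1)) * B gj i s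
    t) a b)"
    using T by (simp add: M_def M0_def fun_eq_iff tensor_matrix_scale sum_divide_distrib)
  have "separable_matrix n ?X M"
    unfolding M_sum using T B fin by (intro separable_matrix_sum psd_matrix_scale) auto
  moreover have "matrix_trace n ?X M \<le> 1"
  proof -
    have "matrix_trace n ?X M = T / (T + 1)"
      by (simp add: matrix_trace_def M_def T_def sum_divide_distrib)
    then show ?thesis using T by simp
  qed
  moreover have "invariant_matrix G n \<phi> ?X M"
    unfolding invariant_matrix_def
  proof (intro ballI)
    fix h a b assume h: "h \<in> carrier G"
    have "M0 (\<lambda>i\<in>{..n}. a (\<phi> h i)) (\<lambda>i\<in>{..n}. b (\<phi> h i))
       = (\<Sum>g\<in>carrier G. \<Sum>j<r. tensor_matrix n (\<lambda>i. B (g, j) (\<phi> (inv h) i)) a b)"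
      unfolding M0_def tensor_matrix_permute[OF assms(1) h] by (simp add: sum.cartesian_product)
    also have "\<dots> = (\<Sum>g\<in>carrier G. \<Sum>j<r. tensor_matrix n (B (h \<otimes> g, j)) a b)"
    proof (intro sum.cong refl tensor_matrix_cong)
      fix g j i assume g: "g \<in> carrier G" and i: "i \<le> n"
      have "\<phi> (inv g) (\<phi> (inv h) i) = \<phi> (inv (h \<otimes> g)) i"
        using composition_rule[of i "inv g" "inv h"] g h i by (simp add: inv_mult_group)
      then show "B (g, j) (\<phi> (inv h) i) (a i) (b i) = B (h \<otimes> g, j) i (a i) (b i)"
        by (simp add: B_def)
    qed
    also have "\<dots> = (\<Sum>g\<in>carrier G. \<Sum>j<r. tensor_matrix n (B (g, j)) a b)"
    proof (rule sum.reindex_bij_betw)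
      show "bij_betw (\<lambda>g. h \<otimes> g) (carrier G) (carrier G)"
        using h by (intro bij_betw_byWitness[where f'
          = "\<lambda>g. inv h \<otimes> g"]) (auto simp: m_assoc[symmetric])
    qed
    also have "\<dots> = M0 a b" by (simp add: M0_def sum.cartesian_product)
    finally show "M (\<lambda>i\<in>{..n}. a (\<phi> h i)) (\<lambda>i\<in>{..n}. b (\<phi> h i)) = M a b" by (simp add: M_def)
  qed
  moreover have "p = poly_const ((T + 1) / real (card (carrier G))) * gram_map n m d M"
  proof (rule poly_eval_inject)
    fix x :: "nat \<times> nat \<Rightarrow> real"
    show "poly_eval x p = poly_eval x (poly_const ((T + 1) / real (card (carrier G))) * gram_map n
      m d M)"
      using T card unfolding M_def gram_map_scale gram_M0 by (simp add: poly_eval_mult)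
  qed
  moreover have "(T + 1) / real (card (carrier G)) > 0"
    using T card by simp
  ultimately show ?thesis unfolding SEP_def by blast
qed

text \<open>With the sphere bound it controls Gram maps uniformly over \<open>SEP\<close>, as the
  case of gauge zero requires.\<close>

lemma SEP_entry_bound:
  assumes X: "finite X" and M: "M \<in> SEP n X" and ab: "a \<in> tuples n X" "b \<in> tuples n X"
  shows "\<bar>M a b\<bar> \<le> 1"
proof -
  obtain r :: nat and A where A: "\<And>j i. j < r \<Longrightarrow> i \<le> n \<Longrightarrow> psd_matrix X (A j i)"
    and MA: "\<And>a b. a \<in> tuples n X \<Longrightarrow> b \<in> tuples n X \<Longrightarrow> M a b = (\<Sum>j<r. tensor_matrix n (A j) a b)"
    using M unfolding SEP_def separable_matrix_def by blast
  have "\<bar>M a b\<bar> \<le> (\<Sum>j<r. \<bar>tensor_matrix n (A j) a b\<bar>)"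
    using MA[OF ab] by simp
  also have "\<dots> \<le> (\<Sum>j<r. matrix_trace n X (tensor_matrix n (A j)))"
    using tensor_matrix_entry_le_trace[OF X A ab] by (intro sum_mono) auto
  also have "\<dots> = matrix_trace n X M"
    unfolding matrix_trace_sum[symmetric] by (simp add: matrix_trace_def MA)
  also have "\<dots> \<le> 1" using M by (simp add: SEP_def)
  finally show ?thesis .
qed

lemma sup_norm_le:
  assumes "\<And>a. \<forall>i\<le>n. L2_set (a i) {..m} = 1 \<Longrightarrow> \<bar>poly_eval (\<lambda>(i, k). a i k) p\<bar> \<le> c"
  shows "sup_norm n m p \<le> c"
  unfolding sup_norm_def
proof (rule cSup_least)
  \<comment> \<open>A supremum is bounded by its upper bounds only over a nonempty set, so a point
    on the spheres is exhibited.\<close>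
  have "L2_set (\<lambda>k. if k = 0 then 1 else 0) {..m} = 1"
    by (simp add: L2_set_def if_distrib[of "\<lambda>x. x\<^sup>2"] cong: if_cong)
  then have "\<exists>a. \<forall>i\<le>n. L2_set (a i) {..m} = 1"
    by (intro exI[of _ "\<lambda>_ k. if k = 0 then 1 else 0"]) simp
  then show "{\<bar>poly_eval (\<lambda>(i, k). a i k) p\<bar> | a. \<forall>i\<le>n. L2_set (a i) {..m} = 1} \<noteq> {}"
    by simp
qed (use assms in auto)

text \<open>As \<open>p\<close> is invariant, \<open>p - q\<close> is the average of the translates
  of \<open>p - s\<close>. Translation merely permutes the spheres, so every translate obeys the
  same bound.\<close>

lemma gauge_approximation:
  fixes G (structure)
  assumes W: "weighted_complex n \<Omega>" and conn: "connected_complex n \<Omega>"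
    and grp: "group G" and fin: "finite (carrier G)"
    and free: "free_complex_action G n \<Omega> \<phi> \<psi>"
    and inv_p: "invariant_poly G \<phi> p"
    and l: "0 < l" and M: "M \<in> SEP n (monomials m d)" and p: "p = poly_const l * gram_map n m d M"
    and k: "0 < k"
  shows "\<exists>q \<in> homogeneous_polys n m (2 * d). sup_norm n m (p - q) \<le> l / sqrt (real k) \<and>
    sep_rank G n m \<Omega> \<phi> \<psi> q \<le> enat (k * card (carrier G))"
proof -
  interpret group G by fact
  have act: "group_action G {..n} \<phi>" using free
    by (simp add: free_complex_action_def complex_action_def)
  interpret V: group_action G "{..n}" \<phi> by (rule act)
  let ?X = "monomials m d" and ?T = "tuples n (monomials m d)"
  define N where "N = real (card (carrier G))"
  have N: "0 < N" using fin one_closed by (auto simp: N_def card_gt_0_iff)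
  have V_in: "\<phi> g i \<le> n" if "g \<in> carrier G" "i \<le> n" for g i
    using V.element_image[of g i] that by auto
  obtain B where B: "\<And>j i. j < k \<Longrightarrow> i \<le> n \<Longrightarrow> psd_matrix ?X (B j i)"
    and err: "(\<Sum>a\<in>?T. \<Sum>b\<in>?T. (l * M a b - (\<Sum>j<k. tensor_matrix n (B j) a b))\<^sup>2) \<le> l\<^sup>2 / real k"
    using SEP_approximation[OF finite_monomials M less_imp_le[OF l] k] by blast
  \<comment> \<open>The factor \<open>1 / N\<close> of the group average is absorbed into the
    matrices, because \<open>q\<close> has to be a plain sum of products of sums of squares.\<close>
  define C where "C j i s t = root (Suc n) (1 / N) * B j i s t" for j i s t
  have C: "psd_matrix ?X (C j i)" if "j < k" "i \<le> n" for j i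
    unfolding C_def using N B that by (intro psd_matrix_scale) auto
  define q where "q = gram_map n m d (\<lambda>a b. \<Sum>j<k. \<Sum>g\<in>carrier G. tensor_matrix n (\<lambda>i. C j (\<phi> (inv
    g) i)) a b)"
  define s where "s = gram_map n m d (\<lambda>a b. \<Sum>j<k. tensor_matrix n (B j) a b)"
  have q_prod: "q = (\<Sum>j<k. \<Sum>g\<in>carrier G. \<Prod>i\<le>n. block_form m d i (C j (\<phi> (inv g) i)))"
    by (simp add: q_def gram_map_sum gram_map_tensor_matrix)
  have "sep_rank G n m \<Omega> \<phi> \<psi> q \<le> enat (k * card (carrier G))"
    by (rule sep_rank_le[OF W conn grp fin free, where P = "\<lambda>j v i. block_form m d i (C j v)"])
      (auto intro: sos_block_form C simp: in_block_block_form q_prod)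
  moreover have "q \<in> homogeneous_polys n m (2 * d)"
    unfolding q_def by (rule gram_map_homogeneous)
  moreover have "sup_norm n m (p - q) \<le> l / sqrt (real k)"
  proof (rule sup_norm_le)
    fix x :: "nat \<Rightarrow> nat \<Rightarrow> real" assume x: "\<forall>i\<le>n. L2_set (x i) {..m} = 1"
    have ps: "p - s = gram_map n m d (\<lambda>a b. l * M a b - (\<Sum>j<k. tensor_matrix n (B j) a b))"
      by (rule poly_eval_inject)
        (simp add: p s_def poly_eval_minus poly_eval_mult poly_eval_gram_map left_diff_distrib
          sum_subtractf sum_distrib_left mult.assoc)
    have le: "\<bar>poly_eval (\<lambda>(i, k). x (\<phi> g i) k) (p - s)\<bar>
      \<le> l / sqrt (real k)" if g: "g \<in> carrier G" for g
    proof -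
      have "(poly_eval (\<lambda>(i, k). x (\<phi> g i) k) (p - s))\<^sup>2 \<le> l\<^sup>2 / real k"
        unfolding ps using x V_in[OF g] by (intro order_trans[OF gram_map_sphere_bound err]) auto
      also have "\<dots> = (l / sqrt (real k))\<^sup>2" by (simp add: power_divide)
      finally have "\<bar>poly_eval (\<lambda>(i, k). x (\<phi> g i) k) (p - s)\<bar> \<le> \<bar>l / sqrt (real k)\<bar>"
        by (simp only: abs_le_square_iff)
      then show ?thesis using l by simp
    qed
    have avg: "N * poly_eval y q = (\<Sum>g\<in>carrier G. poly_eval y (act_poly \<phi> g s))" for y
    proof -
      have "poly_eval y (gram_map n m d (tensor_matrix n (\<lambda>i. C j (\<phi> (inv g) i)))) = 
        poly_eval y (act_poly \<phi> g (gram_map n m d (tensor_matrix n (B j)))) / N"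
          if "g \<in> carrier G" for j g
      proof -
        have "(\<lambda>i. C j (\<phi> (inv g) i)) = (\<lambda>i s t. root (Suc n) (1 / N) * B j (\<phi> (inv g) i) s t)"
          by (simp add: C_def fun_eq_iff)
        then show ?thesis
          using N tensor_matrix_scale[of "1 / N" n "\<lambda>i. B j (\<phi> (inv g) i)"]
          by (simp add: act_poly_gram_map_tensor[OF act that] poly_eval_gram_map sum_divide_distrib)
      qed
      then show ?thesis
        using N by (simp add: q_def s_def gram_map_sum act_poly_sum poly_eval_sum sum_distrib_left
          sum.swap[of _ "{..<k}"])
    qed
    have "N * poly_eval y p = (\<Sum>g\<in>carrier G. poly_eval y (act_poly \<phi> g p))" for y
      using inv_p by (simp add: invariant_poly_def N_def)
    then have "N * poly_eval (\<lambda>(i, k). x i k) (p - q)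
       = (\<Sum>g\<in>carrier G. poly_eval (\<lambda>(i, k). x (\<phi> g i) k) (p - s))"
      using avg by (simp add: poly_eval_minus right_diff_distrib poly_eval_act_poly sum_subtractf)
    also have "\<bar>\<dots>\<bar> \<le> (\<Sum>g\<in>carrier G. l / sqrt (real k))"
      by (intro order_trans[OF sum_abs] sum_mono le)
    also have "\<dots> = N * (l / sqrt (real k))" by (simp add: N_def)
    finally have "N * \<bar>poly_eval (\<lambda>(i, k). x i k) (p - q)\<bar> \<le> N * (l / sqrt (real k))"
      using N by (simp only: abs_mult abs_of_pos)
    then show "\<bar>poly_eval (\<lambda>(i, k). x i k) (p - q)\<bar> \<le> l / sqrt (real k)"
      using N by (simp only: mult_le_cancel_left_pos)
  qed
  ultimately show ?thesis by blast
qed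

theorem theorem49:
  fixes G :: "('g, 'b) monoid_scheme"
    and n m d :: nat
    and \<Omega> :: "nat set \<Rightarrow> nat"
    and \<phi> :: "'g \<Rightarrow> nat \<Rightarrow> nat"
    and \<psi> :: "'g \<Rightarrow> nat set \<times> nat \<Rightarrow> nat set \<times> nat"
    and \<epsilon> :: real
    and p :: "(nat \<times> nat) rpoly"
  assumes "weighted_complex n \<Omega>"
    and "connected_complex n \<Omega>"
    and "group G" and "finite (carrier G)"
    and "free_complex_action G n \<Omega> \<phi> \<psi>"
    and "\<epsilon> > 0"
    and "p \<in> homogeneous_polys n m (2 * d)"
    and "separable_poly n m p"
    and "invariant_poly G \<phi> p"
  shows "\<exists>q \<in> homogeneous_polys n m (2 * d).
           sup_norm n m (p - q) < \<epsilon> \<and>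
           sep_rank G n m \<Omega> \<phi> \<psi> q
             \<le> enat (nat \<lceil>8 * exp 4 * (sep_gauge G n m d \<phi> p)\<^sup>2 / \<epsilon>\<^sup>2\<rceil> * card (carrier G))"
proof -
  define \<mu> where "\<mu> = sep_gauge G n m d \<phi> p"
  define S where "S = {l. l > 0 \<and> (\<exists>M\<in>SEP n (monomials m d).
     invariant_matrix G n \<phi> (monomials m d) M \<and> p = poly_const l * gram_map n m d M)}"
  let ?T = "tuples n (monomials m d)"
  have act: "group_action G {..n} \<phi>"
    using assms(5) by (simp add: free_complex_action_def complex_action_def)
  have S_ne: "S \<noteq> {}"
    using sep_gauge_feasible[OF act assms(4,7,8,9)] by (auto simp: S_def)
  have \<mu>: "\<mu> = Inf S" by (simp add: \<mu>_def S_def sep_gauge_def)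
  have "0 \<le> \<mu>" unfolding \<mu> using S_ne by (intro cInf_greatest) (auto simp: S_def)
  then consider "\<mu> = 0" | "0 < \<mu>" by linarith
  then show ?thesis
  proof cases
    case 1
    \<comment> \<open>The bound \<open>\<epsilon> / 2\<close> is aimed at because suprema yield only
      a weak inequality.\<close>
    have "sup_norm n m (p - 0) \<le> \<epsilon> / 2"
    proof (rule sup_norm_le)
      fix x :: "nat \<Rightarrow> nat \<Rightarrow> real" assume x: "\<forall>i\<le>n. L2_set (x i) {..m} = 1"
      \<comment> \<open>Chosen such that any feasible \<open>l < c\<close> makes
        \<open>l * card ?T\<close> at most \<open>\<epsilon> / 2\<close>; adding 1 keeps the
        denominator positive.\<close>
      define c where "c = \<epsilon> / 2 / (real (card ?T) + 1)"
      have K: "real (card ?T) + 1 \<noteq> 0" by linarith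
      have "0 < c" using assms(6) by (simp add: c_def)
      then obtain l where "l \<in> S" "l < c"
        using cInf_lessD[OF S_ne] 1 \<mu> by metis
      then obtain M where l: "0 < l" and M: "M \<in> SEP n (monomials m d)" and p: "p
        = poly_const l * gram_map n m d M"
        by (auto simp: S_def)
      have "(poly_eval (\<lambda>(i, k). x i k) (gram_map n m d M))\<^sup>2 \<le> (\<Sum>a\<in>?T. \<Sum>b\<in>?T. (M a b)\<^sup>2)"
        using x by (intro gram_map_sphere_bound) auto
      also have "\<dots> \<le> (\<Sum>a\<in>?T. \<Sum>b\<in>?T. 1)"
        using SEP_entry_bound[OF finite_monomials M] by (intro sum_mono) (simp add: abs_square_le_1)
      also have "\<dots> = (real (card ?T))\<^sup>2" by (simp add: power2_eq_square)
      finally have "\<bar>poly_eval (\<lambda>(i, k). x i k) (gram_map n m d M)\<bar> \<le> real (card ?T)"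
        by (simp flip: abs_le_square_iff)
      then have "\<bar>poly_eval (\<lambda>(i, k). x i k) p\<bar> \<le> l * real (card ?T)"
        using l by (simp add: p poly_eval_mult abs_mult)
      also have "\<dots> \<le> c * (real (card ?T) + 1)"
        using l \<open>l < c\<close> by (intro mult_mono) auto
      also have "\<dots> = \<epsilon> / 2" 
        unfolding c_def using nonzero_eq_divide_eq[OF K] by blast
      finally show "\<bar>poly_eval (\<lambda>(i, k). x i k) (p - 0)\<bar> \<le> \<epsilon> / 2" by simp
    qed
    then have "sup_norm n m (p - 0) < \<epsilon>" using assms(6) by linarith
    \<comment> \<open>With \<open>k = 0\<close> the index set is empty, and the decomposition is
      that of the zero polynomial.\<close>
    moreover have "sep_rank G n m \<Omega> \<phi> \<psi> 0 \<le> enat (0 * card (carrier G))"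
      by (rule sep_rank_le[OF assms(1-5), where P = "\<lambda>_ _ _. 0"])
        (auto simp: in_block_def poly_subst_def)
    moreover have "0 \<in> homogeneous_polys n m (2 * d)"
      by (simp add: homogeneous_polys_def polys_in_0)
    ultimately show ?thesis using 1 unfolding \<mu>_def by (intro bexI[of _ 0]) auto
  next
    case 2
    define k where "k = nat \<lceil>8 * exp 4 * \<mu>\<^sup>2 / \<epsilon>\<^sup>2\<rceil>"
    have k_ge: "8 * exp 4 * \<mu>\<^sup>2 / \<epsilon>\<^sup>2 \<le> real k" unfolding k_def by linarith
    have "0 < 8 * exp 4 * \<mu>\<^sup>2 / \<epsilon>\<^sup>2" using 2 assms(6) by simp
    then have k: "0 < k" using k_ge by linarith
    have "Inf S < 2 * \<mu>" using 2 \<mu> by simp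
    then obtain l where "l \<in> S" and l2: "l < 2 * \<mu>" using cInf_lessD[OF S_ne] by blast
    then obtain M where l: "0 < l" and M: "M \<in> SEP n (monomials m d)" and p: "p
      = poly_const l * gram_map n m d M"
      by (auto simp: S_def)
    \<comment> \<open>The constant enters through \<open>4 \<le> 8 * exp 4\<close>; the strictness
      of \<open>l < 2 * \<mu>\<close> provides the strict inequality for the norm.\<close>
    have "l\<^sup>2 < (2 * \<mu>)\<^sup>2" using l l2 by (intro power_strict_mono) auto
    also have "\<dots> \<le> 8 * exp 4 * \<mu>\<^sup>2"
    proof -
      have "1 \<le> exp (4::real)" by simp
      then have "4 * \<mu>\<^sup>2 \<le> (8 * exp 4) * \<mu>\<^sup>2" by (intro mult_right_mono, linarith, simp)
      then show ?thesis by (simp add: power_mult_distrib)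
    qed
    also have "\<dots> \<le> \<epsilon>\<^sup>2 * real k" using k_ge assms(6) by (simp add: field_simps)
    finally have "l / sqrt (real k) < \<epsilon>"
      using l k assms(6) real_less_rsqrt[of l "\<epsilon>\<^sup>2 * real k"]
        by (simp add: real_sqrt_mult field_simps)
    moreover obtain q where "q \<in> homogeneous_polys n m (2 * d)"
      and "sup_norm n m (p - q) \<le> l / sqrt (real k)"
      and "sep_rank G n m \<Omega> \<phi> \<psi> q \<le> enat (k * card (carrier G))"
      using gauge_approximation[OF assms(1-5,9) l M p k] by blast
    ultimately show ?thesis
      unfolding k_def \<mu>_def by (intro bexI[of _ q]) auto
  qed
qed

end
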